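(* For a power bounded $T\in\mathcal{B}(\mathbb{C}^d)$ the following are equivalent: (i) the sequence $\{T^{*n}T^n\}_{n\ge1}$ converges; (ii) eigenspaces of $T$ corresponding to distinct eigenvalues of modulus $1$ are mutually orthogonal. Moreover, the following three sets coincide: $\{A:\ A=\lim_{n\to\infty}T^{*n}T^n$ for some power bounded $T\in\mathcal{B}(\mathbb{C}^d)$ for which the limit exists$\}$; $\{P^*P:\ P\in\mathcal{B}(\mathbb{C}^d),\ P^2=P\}$; $\{A\in\mathcal{B}(\mathbb{C}^d)$ positive semidefinite$:\ \sigma(A)\subseteq\{0\}\cup[1,\infty)$ and $\dim\ker A\ge\operatorname{rank}E(]1,\infty[)\}$, where $E$ is the spectral measure of $A$.
   Context: $T$ is power bounded if $\sup_n\|T^n\|<\infty$. $\sigma(A)$ denotes the spectrum. *)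

theory Defs
  imports "Jordan_Normal_Form.Schur_Decomposition" "Jordan_Normal_Form.Spectral_Radius"
    "Jordan_Normal_Form.DL_Rank" "Jordan_Normal_Form.Matrix_Kernel"
begin

definition vnorm :: "complex vec \<Rightarrow> real" where
  "vnorm v = sqrt (Re (v \<bullet>c v))"

definition op_norm :: "nat \<Rightarrow> complex mat \<Rightarrow> real" where
  "op_norm d T = Sup ((\<lambda>v. vnorm (T *\<^sub>v v)) ` {v \<in> carrier_vec d. vnorm v \<le> 1})"

definition power_bounded :: "nat \<Rightarrow> complex mat \<Rightarrow> bool" where
  "power_bounded d T \<longleftrightarrow> (\<exists>C. \<forall>n. op_norm d (T ^\<^sub>m n) \<le> C)"

definition mat_tendsto :: "nat \<Rightarrow> (nat \<Rightarrow> complex mat) \<Rightarrow> complex mat \<Rightarrow> bool" where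
  "mat_tendsto d M L \<longleftrightarrow> L \<in> carrier_mat d d \<and> (\<lambda>n. op_norm d (M n - L)) \<longlonglongrightarrow> 0"

definition mat_convergent :: "nat \<Rightarrow> (nat \<Rightarrow> complex mat) \<Rightarrow> bool" where
  "mat_convergent d M \<longleftrightarrow> (\<exists>L. mat_tendsto d M L)"

definition psd :: "nat \<Rightarrow> complex mat \<Rightarrow> bool" where
  "psd d A \<longleftrightarrow> A \<in> carrier_mat d d \<and> mat_adjoint A = A \<and>
     (\<forall>v \<in> carrier_vec d. (A *\<^sub>v v) \<bullet>c v \<ge> 0)"

text \<open>Range of the spectral projection E(S) of a Hermitian matrix A:
  the span of all eigenvectors of A with eigenvalues in S.\<close>
definition spectral_subspace :: "nat \<Rightarrow> complex mat \<Rightarrow> complex set \<Rightarrow> complex vec set" where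
  "spectral_subspace d A S =
     LinearCombinations.module.span class_ring (module_vec TYPE(complex) d)
       {v. \<exists>c\<in>S. eigenvector A v c}"

definition spectral_measure :: "nat \<Rightarrow> complex mat \<Rightarrow> complex set \<Rightarrow> complex mat" where
  "spectral_measure d A S = (THE P. P \<in> carrier_mat d d \<and>
     (\<forall>v \<in> carrier_vec d. P *\<^sub>v v \<in> spectral_subspace d A S) \<and>
     (\<forall>v \<in> carrier_vec d. \<forall>w \<in> spectral_subspace d A S. (v - P *\<^sub>v v) \<bullet>c w = 0))"

definition mat_rank :: "nat \<Rightarrow> complex mat \<Rightarrow> nat" where
  "mat_rank d P = vec_space.rank d P"

end

theory Submission
  imports Defs "HOL-Analysis.L2_Norm"
begin

text \<open>
  In a Jordan basis of a power bounded \<open>T\<close> every basis vector is either an eigenvector with a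
  unimodular eigenvalue or has an orbit tending to \<open>0\<close>, since a longer chain at a unimodular
  eigenvalue would grow linearly. Let \<open>P\<close> be the idempotent that keeps the former and kills
  the latter. If eigenspaces of distinct unimodular eigenvalues are orthogonal, then the inner products
  \<open>\<langle>T\<^sup>n b, T\<^sup>n b'\<rangle>\<close> of basis vectors converge to \<open>\<langle>P b, P b'\<rangle>\<close>, so the limit is \<open>P\<^sup>* P\<close>.
  Conversely, \<open>\<langle>T\<^sup>n v, T\<^sup>n w\<rangle> = (l \<cdot> cnj m)\<^sup>n \<langle>v, w\<rangle>\<close> for eigenvectors \<open>v\<close>, \<open>w\<close>, which converges for
  \<open>l \<noteq> m\<close> only if \<open>\<langle>v, w\<rangle> = 0\<close>.

  For \<open>A = P\<^sup>* P\<close> with \<open>P\<close> idempotent, \<open>1 - P\<close> maps the span of the eigenvectors of \<open>A\<close> with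
  eigenvalue greater than \<open>1\<close> injectively into \<open>ker P = ker A\<close>: on that span \<open>P v = v\<close> would give
  \<open>\<langle>A v, v\<rangle> = \<parallel>v\<parallel>\<^sup>2\<close>, forcing \<open>v = 0\<close>. Conversely an injection of the eigenvalues greater than \<open>1\<close> into the kernel
  directions yields an explicit \<open>P\<close> in an orthonormal eigenbasis of \<open>A\<close>.
\<close>


subsection \<open>Adjoints and the Hermitian inner product\<close>

lemma mat_adjoint_dim [simp]:
  "dim_row (mat_adjoint A) = dim_col A" "dim_col (mat_adjoint A) = dim_row A"
  unfolding mat_adjoint_def by auto

lemma mat_adjoint_carrier [simp]:
  "A \<in> carrier_mat nr nc \<Longrightarrow> mat_adjoint A \<in> carrier_mat nc nr"
  by (intro carrier_matI) simp_all

lemma mat_adjoint_index [simp]: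
  "i < dim_col A \<Longrightarrow> j < dim_row A \<Longrightarrow> mat_adjoint A $$ (i, j) = conjugate (A $$ (j, i))"
  unfolding mat_adjoint_def by (simp add: mat_of_rows_def)

lemma mat_adjoint_mult:
  fixes A B :: "complex mat"
  assumes "A \<in> carrier_mat n m" "B \<in> carrier_mat m k"
  shows "mat_adjoint (A * B) = mat_adjoint B * mat_adjoint A"
  using assms by (intro eq_matI) (auto simp: scalar_prod_def intro!: sum.cong)

lemma mat_adjoint_adjoint [simp]: "mat_adjoint (mat_adjoint (A :: complex mat)) = A"
  by (intro eq_matI) auto

lemma mat_adjoint_one [simp]: "mat_adjoint (1\<^sub>m n :: complex mat) = 1\<^sub>m n"
  by (intro eq_matI) auto

lemma cscalar_prod_eq_sum:
  fixes v w :: "complex vec"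
  assumes "w \<in> carrier_vec n"
  shows "v \<bullet>c w = (\<Sum>i<n. v $ i * cnj (w $ i))"
  using assms by (auto simp: scalar_prod_def atLeast0LessThan intro!: sum.cong)

lemma mult_mat_vec_index_sum:
  assumes "A \<in> carrier_mat nr nc" "v \<in> carrier_vec nc" "i < nr"
  shows "(A *\<^sub>v v) $ i = (\<Sum>j<nc. A $$ (i, j) * v $ j)"
  using assms by (auto simp: scalar_prod_def atLeast0LessThan intro!: sum.cong)

lemma mult_mat_index_sum:
  assumes "A \<in> carrier_mat n m" "B \<in> carrier_mat m k" "i < n" "j < k"
  shows "(A * B) $$ (i, j) = (\<Sum>l<m. A $$ (i, l) * B $$ (l, j))"
  using assms by (auto simp: scalar_prod_def atLeast0LessThan intro!: sum.cong)

lemma cscalar_prod_adjoint: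
  fixes A :: "complex mat"
  assumes A: "A \<in> carrier_mat nr nc" and v: "v \<in> carrier_vec nc" and w: "w \<in> carrier_vec nr"
  shows "(A *\<^sub>v v) \<bullet>c w = v \<bullet>c (mat_adjoint A *\<^sub>v w)"
proof -
  have A': "mat_adjoint A \<in> carrier_mat nc nr" using A by simp
  have A'w: "mat_adjoint A *\<^sub>v w \<in> carrier_vec nc"
    using mult_mat_vec_carrier[OF A' w] .
  have "(A *\<^sub>v v) \<bullet>c w = (\<Sum>i<nr. \<Sum>j<nc. A $$ (i, j) * v $ j * cnj (w $ i))"
    using A v by (simp add: cscalar_prod_eq_sum[OF w] mult_mat_vec_index_sum[OF A v] sum_distrib_right
        del: index_mult_mat_vec)
  also have "\<dots> = (\<Sum>j<nc. \<Sum>i<nr. A $$ (i, j) * v $ j * cnj (w $ i))"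
    by (rule sum.swap)
  also have "\<dots> = v \<bullet>c (mat_adjoint A *\<^sub>v w)"
    using A by (simp add: cscalar_prod_eq_sum[OF A'w] mult_mat_vec_index_sum[OF A' w] sum_distrib_left
        mult_ac del: index_mult_mat_vec)
  finally show ?thesis .
qed

lemma cscalar_prod_cnj:
  fixes v w :: "complex vec"
  assumes "v \<in> carrier_vec n" "w \<in> carrier_vec n"
  shows "w \<bullet>c v = cnj (v \<bullet>c w)"
  by (simp add: cscalar_prod_eq_sum[OF assms(1)] cscalar_prod_eq_sum[OF assms(2)] mult.commute)

lemma cscalar_prod_smult:
  fixes v w :: "complex vec"
  assumes "v \<in> carrier_vec n" "w \<in> carrier_vec n"
  shows "(a \<cdot>\<^sub>v v) \<bullet>c w = a * (v \<bullet>c w)" "v \<bullet>c (a \<cdot>\<^sub>v w) = cnj a * (v \<bullet>c w)"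
  using assms by (simp_all add: conjugate_smult_vec)

lemma cscalar_prod_self:
  fixes v :: "complex vec"
  assumes "v \<in> carrier_vec n"
  shows "v \<bullet>c v = complex_of_real ((vnorm v)\<^sup>2)"
  using conjugate_square_ge_0_vec[of v]
  by (simp add: vnorm_def less_eq_complex_def complex_eq_iff)

lemma vnorm_eq_0_iff:
  assumes "v \<in> carrier_vec n"
  shows "vnorm v = 0 \<longleftrightarrow> v = 0\<^sub>v n"
  using conjugate_square_eq_0_vec[OF assms] cscalar_prod_self[OF assms] by simp

text \<open>This puts the norm in the form for which the triangle-type estimates and the
  Cauchy-Schwarz inequality for \<open>L2_set\<close> are available.\<close>

lemma vnorm_L2_set:
  assumes "v \<in> carrier_vec n"
  shows "vnorm v = L2_set (\<lambda>i. cmod (v $ i)) {..<n}"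
  using assms
  by (simp add: vnorm_def L2_set_def cscalar_prod_eq_sum[OF assms] complex_mult_cnj cmod_power2)

lemma vnorm_nonneg [simp]: "vnorm v \<ge> 0"
  using vnorm_L2_set[of v "dim_vec v"] by (simp add: L2_set_nonneg)

lemma cmod_cscalar_prod_le:
  assumes v: "v \<in> carrier_vec n" and w: "w \<in> carrier_vec n"
  shows "cmod (v \<bullet>c w) \<le> vnorm v * vnorm w"
proof -
  have "cmod (v \<bullet>c w) \<le> (\<Sum>i<n. \<bar>cmod (v $ i)\<bar> * \<bar>cmod (w $ i)\<bar>)"
    by (auto simp: cscalar_prod_eq_sum[OF w] norm_mult intro!: sum_norm_le)
  also have "\<dots> \<le> vnorm v * vnorm w"
    unfolding vnorm_L2_set[OF v] vnorm_L2_set[OF w] by (rule L2_set_mult_ineq)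
  finally show ?thesis .
qed

lemma eq_mat_mult_vecI:
  fixes A B :: "complex mat"
  assumes A: "A \<in> carrier_mat nr nc" and B: "B \<in> carrier_mat nr nc"
    and eq: "\<And>v. v \<in> carrier_vec nc \<Longrightarrow> A *\<^sub>v v = B *\<^sub>v v"
  shows "A = B"
proof (rule eq_matI)
  fix i j assume ij: "i < dim_row B" "j < dim_col B"
  have "(A *\<^sub>v unit_vec nc j) $ i = (B *\<^sub>v unit_vec nc j) $ i" using eq by simp
  then show "A $$ (i, j) = B $$ (i, j)" using ij A B by simp
qed (use A B in auto)

subsection \<open>Operator norm and entrywise convergence\<close>

text \<open>The Euclidean norm is at most the sum of the moduli of the entries, and entries of a
  vector in the unit ball have modulus at most 1. Since \<open>op_norm\<close> is a real
  \<open>Sup\<close>, this upper bound is what gives it meaning.\<close>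

lemma vnorm_mult_mat_vec_le:
  assumes M: "M \<in> carrier_mat d d" and v: "v \<in> carrier_vec d" and "vnorm v \<le> 1"
  shows "vnorm (M *\<^sub>v v) \<le> (\<Sum>i<d. \<Sum>j<d. cmod (M $$ (i, j)))"
proof -
  have v1: "cmod (v $ j) \<le> 1" if "j < d" for j
    using member_le_L2_set[of "{..<d}" j "\<lambda>i. cmod (v $ i)"] that assms(3) vnorm_L2_set[OF v] by simp
  have "vnorm (M *\<^sub>v v) \<le> (\<Sum>i<d. cmod ((M *\<^sub>v v) $ i))"
    using L2_set_le_sum_abs[of "\<lambda>i. cmod ((M *\<^sub>v v) $ i)" "{..<d}"]
      vnorm_L2_set[OF mult_mat_vec_carrier[OF M v]] by simp
  also have "\<dots> \<le> (\<Sum>i<d. \<Sum>j<d. cmod (M $$ (i, j)))"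
  proof (intro sum_mono)
    fix i assume i: "i \<in> {..<d}"
    have "cmod ((M *\<^sub>v v) $ i) \<le> (\<Sum>j<d. cmod (M $$ (i, j)) * cmod (v $ j))"
      using i by (simp add: mult_mat_vec_index_sum[OF M v] norm_mult sum_norm_le del: index_mult_mat_vec)
    also have "\<dots> \<le> (\<Sum>j<d. cmod (M $$ (i, j)))"
      using v1 by (intro sum_mono) (simp add: mult_left_le)
    finally show "cmod ((M *\<^sub>v v) $ i) \<le> (\<Sum>j<d. cmod (M $$ (i, j)))" .
  qed
  finally show ?thesis .
qed

lemma op_norm_le_sum:
  assumes M: "M \<in> carrier_mat d d"
  shows "op_norm d M \<le> (\<Sum>i<d. \<Sum>j<d. cmod (M $$ (i, j)))"
proof -
  \<comment> \<open>The zero vector shows the unit ball to be nonempty for every \<open>d\<close>,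
    including \<open>d = 0\<close>; a least upper bound argument requires this.\<close>
  have "0\<^sub>v d \<in> {v \<in> carrier_vec d. vnorm v \<le> 1}"
    using vnorm_eq_0_iff[of "0\<^sub>v d" d] by simp
  then show ?thesis
    unfolding op_norm_def using vnorm_mult_mat_vec_le[OF M]
    by (intro cSUP_least) (blast, simp)
qed

lemma cmod_index_le_op_norm:
  assumes M: "M \<in> carrier_mat d d" and ij: "i < d" "j < d"
  shows "cmod (M $$ (i, j)) \<le> op_norm d M"
proof -
  have e: "unit_vec d j \<in> carrier_vec d" by simp
  have "vnorm (unit_vec d j) = 1" using ij unfolding vnorm_def by simp
  then have "vnorm (M *\<^sub>v unit_vec d j) \<le> op_norm d M"
    unfolding op_norm_def using vnorm_mult_mat_vec_le[OF M]
    by (intro cSUP_upper bdd_aboveI2[where M = "\<Sum>i<d. \<Sum>j<d. cmod (M $$ (i, j))"]) auto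
  moreover have "cmod ((M *\<^sub>v unit_vec d j) $ i) \<le> vnorm (M *\<^sub>v unit_vec d j)"
    unfolding vnorm_L2_set[OF mult_mat_vec_carrier[OF M e]]
    using ij by (intro member_le_L2_set) auto
  moreover have "(M *\<^sub>v unit_vec d j) $ i = M $$ (i, j)" using M ij by simp
  ultimately show ?thesis by simp
qed

text \<open>The operator norm dominates each single entry and is dominated by the sum of all of
  them, so both topologies agree. Later limits are computed entry by entry through this
  equivalence.\<close>

lemma mat_tendsto_iff_entrywise:
  assumes M: "\<And>n. M n \<in> carrier_mat d d"
  shows "mat_tendsto d M L \<longleftrightarrow> L \<in> carrier_mat d d \<and>
    (\<forall>i<d. \<forall>j<d. (\<lambda>n. M n $$ (i, j)) \<longlonglongrightarrow> L $$ (i, j))"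
proof (cases "L \<in> carrier_mat d d")
  case L: True
  have diff: "M n - L \<in> carrier_mat d d" for n using L by (simp add: minus_carrier_mat)
  have idx: "(M n - L) $$ (i, j) = M n $$ (i, j) - L $$ (i, j)" if "i < d" "j < d" for n i j
    using M[of n] L that by simp
  have "(\<lambda>n. M n $$ (i, j)) \<longlonglongrightarrow> L $$ (i, j)"
    if lim: "(\<lambda>n. op_norm d (M n - L)) \<longlonglongrightarrow> 0" and ij: "i < d" "j < d" for i j
  proof (rule LIM_zero_cancel, rule tendsto_0_le[OF lim, where K = 1])
    show "\<forall>\<^sub>F n in sequentially. norm (M n $$ (i, j) - L $$ (i, j)) \<le> norm (op_norm d (M n - L)) * 1"
      using order_trans[OF cmod_index_le_op_norm[OF diff ij] abs_ge_self] idx[OF ij]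
      by (intro always_eventually) simp
  qed
  moreover have "(\<lambda>n. op_norm d (M n - L)) \<longlonglongrightarrow> 0"
    if lim: "\<And>i j. i < d \<Longrightarrow> j < d \<Longrightarrow> (\<lambda>n. M n $$ (i, j)) \<longlonglongrightarrow> L $$ (i, j)"
  proof (rule tendsto_0_le[where K = 1])
    \<comment> \<open>The supremum is taken over a bounded set that contains the norm of the image
      of the zero vector, so it cannot be negative.\<close>
    have "0 \<le> op_norm d (M n - L)" for n
    proof -
      have "0\<^sub>v d \<in> {v \<in> carrier_vec d. vnorm v \<le> 1}"
        using vnorm_eq_0_iff[of "0\<^sub>v d" d] by simp
      then have "vnorm ((M n - L) *\<^sub>v 0\<^sub>v d) \<le> op_norm d (M n - L)"
        unfolding op_norm_def using vnorm_mult_mat_vec_le[OF diff]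
        by (intro cSUP_upper bdd_aboveI2[where M = "\<Sum>i<d. \<Sum>j<d. cmod ((M n - L) $$ (i, j))"]) auto
      then show ?thesis by (rule order_trans[OF vnorm_nonneg])
    qed
    then show "\<forall>\<^sub>F n in sequentially. norm (op_norm d (M n - L)) \<le>
        norm (\<Sum>i<d. \<Sum>j<d. cmod (M n $$ (i, j) - L $$ (i, j))) * 1"
      using order_trans[OF op_norm_le_sum[OF diff] abs_ge_self] idx
      by (intro always_eventually allI) simp
    show "(\<lambda>n. \<Sum>i<d. \<Sum>j<d. cmod (M n $$ (i, j) - L $$ (i, j))) \<longlonglongrightarrow> 0"
      using lim by (intro tendsto_null_sum tendsto_norm_zero LIM_zero) auto
  qed
  ultimately show ?thesis using L unfolding mat_tendsto_def by blast
qed (simp add: mat_tendsto_def)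

lemma mat_tendsto_unique:
  assumes M: "\<And>n. M n \<in> carrier_mat d d" and "mat_tendsto d M L" "mat_tendsto d M L'"
  shows "L = L'"
proof -
  have L: "L \<in> carrier_mat d d" "L' \<in> carrier_mat d d"
    using assms(2,3) by (auto simp: mat_tendsto_def)
  have "L $$ (i, j) = L' $$ (i, j)" if "i < d" "j < d" for i j
    using assms(2,3) that unfolding mat_tendsto_iff_entrywise[OF M] by (metis LIMSEQ_unique)
  then show ?thesis using L by (intro eq_matI) auto
qed

text \<open>Entries of \<open>A * X * B\<close> are finite linear combinations of entries of
  \<open>X\<close>. The lemma serves to return from Gram matrices in a Jordan basis to Gram matrices
  in the standard basis.\<close>

lemma mat_tendsto_congruence:
  assumes M: "\<And>n. M n \<in> carrier_mat d d" and A: "A \<in> carrier_mat d d" and B: "B \<in> carrier_mat d d"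
    and lim: "mat_tendsto d M L"
  shows "mat_tendsto d (\<lambda>n. A * M n * B) (A * L * B)"
proof -
  have L: "L \<in> carrier_mat d d" using lim by (simp add: mat_tendsto_def)
  have ABM: "A * M n * B \<in> carrier_mat d d" for n using A B M[of n] by simp
  have e: "(A * X * B) $$ (i, j) = (\<Sum>k<d. (\<Sum>l<d. A $$ (i, l) * X $$ (l, k)) * B $$ (k, j))"
    if "X \<in> carrier_mat d d" "i < d" "j < d" for X i j
  proof -
    have AX: "A * X \<in> carrier_mat d d" using A that by simp
    show ?thesis using that
      by (simp add: mult_mat_index_sum[OF AX B] mult_mat_index_sum[OF A that(1)] del: index_mult_mat(1))
  qed
  show ?thesis
    using lim A B unfolding mat_tendsto_iff_entrywise[OF M] mat_tendsto_iff_entrywise[OF ABM]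
    by (auto simp: e[OF M] e[OF L] simp del: index_mult_mat(1)
        intro!: tendsto_sum tendsto_mult tendsto_const)
qed


subsection \<open>Jordan chains\<close>

text \<open>A superdiagonal 1 lies inside a single block, so the two diagonal entries next to it
  agree. The induction peels off the first block and shifts both indices by its size.\<close>

lemma jordan_matrix_index:
  assumes "i < sum_list (map fst n_as)" "j < sum_list (map fst n_as)"
  shows "i \<noteq> j \<Longrightarrow> Suc i \<noteq> j \<Longrightarrow> jordan_matrix n_as $$ (i, j) = 0"
    and "Suc i = j \<Longrightarrow> jordan_matrix n_as $$ (i, j) = 0 \<or>
      jordan_matrix n_as $$ (i, j) = 1 \<and> jordan_matrix n_as $$ (i, i) = jordan_matrix n_as $$ (j, j)"
  using assms
proof (atomize(full), induct n_as arbitrary: i j)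
  case (Cons na n_as)
  obtain n a where na: "na = (n, a)" by force
  let ?s = "sum_list (map fst n_as)"
  have idx: "jordan_matrix (na # n_as) $$ (i, j) =
    (if i < n then if j < n then jordan_block n a $$ (i, j) else 0
     else if j < n then 0 else jordan_matrix n_as $$ (i - n, j - n))"
    if "i < n + ?s" "j < n + ?s" for i j
    using that unfolding na jordan_matrix_Cons by (subst index_mat_four_block) auto
  have ij: "i < n + ?s" "j < n + ?s" using Cons(2,3) by (auto simp: na)
  show ?case
  proof (cases "i < n \<or> j < n")
    case True
    then show ?thesis using ij by (auto simp: idx)
  next
    case False
    then have "i - n < ?s" "j - n < ?s" "i - n = j - n \<longleftrightarrow> i = j" "Suc (i - n) = j - n \<longleftrightarrow> Suc i = j"
      using ij by auto
    with Cons(1)[of "i - n" "j - n"] show ?thesis using False by (simp add: idx[OF ij] idx[OF ij(1,1)] idx[OF ij(2,2)])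
  qed
qed auto

text \<open>Reading \<open>T * S = S * J\<close> column by column replaces the block structure by a
  basis in which each vector is an eigenvector or sits on top of its predecessor in a chain with the
  same eigenvalue.\<close>

lemma jordan_chains:
  fixes T :: "complex mat"
  assumes T: "T \<in> carrier_mat d d"
  obtains S R a where "S \<in> carrier_mat d d" "R \<in> carrier_mat d d" "S * R = 1\<^sub>m d" "R * S = 1\<^sub>m d"
    "\<And>j. j < d \<Longrightarrow> T *\<^sub>v col S j = a j \<cdot>\<^sub>v col S j \<or>
      (\<exists>i. j = Suc i \<and> a i = a j \<and> T *\<^sub>v col S j = a j \<cdot>\<^sub>v col S j + col S i)"
proof -
  obtain as where "char_poly T = (\<Prod>a\<leftarrow>as. [:- a, 1:])" using char_poly_factorized[OF T] by auto
  from jordan_nf_exists[OF T this] obtain n_as where "jordan_nf T n_as" by auto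
  then obtain S R where wit: "similar_mat_wit T (jordan_matrix n_as) S R"
    unfolding jordan_nf_def similar_mat_def by auto
  define J where "J = jordan_matrix n_as"
  note w = similar_mat_witD2[OF T wit, folded J_def]
  have S: "S \<in> carrier_mat d d" and R: "R \<in> carrier_mat d d" and J: "J \<in> carrier_mat d d"
    and SR: "S * R = 1\<^sub>m d" and RS: "R * S = 1\<^sub>m d" and TJ: "T = S * J * R" using w by auto
  have dim: "sum_list (map fst n_as) = d" using J unfolding J_def by auto
  have TS: "T * S = S * J"
  proof -
    have "T * S = S * J * (R * S)" unfolding TJ using S J R by (simp add: assoc_mult_mat[of _ d d _ d _ d])
    then show ?thesis unfolding RS using S J by simp
  qed
  note Ji = jordan_matrix_index[where n_as = n_as, unfolded dim, folded J_def]
  define a where "a j = J $$ (j, j)" for j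
  have chain: "T *\<^sub>v col S j = a j \<cdot>\<^sub>v col S j \<or>
      (\<exists>i. j = Suc i \<and> a i = a j \<and> T *\<^sub>v col S j = a j \<cdot>\<^sub>v col S j + col S i)" if j: "j < d" for j
  proof -
    have TSj: "T *\<^sub>v col S j = S *\<^sub>v col J j"
      using col_mult2[OF T S j] col_mult2[OF S J j] unfolding TS by simp
    have e: "(T *\<^sub>v col S j) $ k = (\<Sum>i<d. S $$ (k, i) * J $$ (i, j))" if "k < d" for k
      using that j J S unfolding TSj
      by (simp add: mult_mat_vec_index_sum[OF S, of "col J j"] del: index_mult_mat_vec)
    show ?thesis
    proof (cases "\<exists>i. j = Suc i \<and> J $$ (i, j) \<noteq> 0")
      case True
      then obtain i where i: "j = Suc i" "J $$ (i, j) \<noteq> 0" by auto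
      have "i < d" using i(1) j by simp
      from Ji(2)[OF this j i(1)[symmetric]] i(2) have ad: "J $$ (i, j) = 1" "a i = a j"
        unfolding a_def by blast+
      have "(T *\<^sub>v col S j) $ k = a j * S $$ (k, j) + S $$ (k, i)" if k: "k < d" for k
      proof -
        \<comment> \<open>Column \<open>j\<close> of \<open>J\<close> vanishes outside its diagonal
          and superdiagonal entries.\<close>
        have "(T *\<^sub>v col S j) $ k = (\<Sum>l\<in>{i, j}. S $$ (k, l) * J $$ (l, j))"
          unfolding e[OF k] using j i(1) by (intro sum.mono_neutral_right) (auto simp: Ji(1))
        then show ?thesis using ad i by (simp add: a_def)
      qed
      then have "T *\<^sub>v col S j = a j \<cdot>\<^sub>v col S j + col S i"
        using T S j i(1) by (intro eq_vecI) (auto simp del: index_mult_mat_vec)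
      then show ?thesis using i ad by auto
    next
      case False
      have "(T *\<^sub>v col S j) $ k = a j * S $$ (k, j)" if k: "k < d" for k
      proof -
        have "(T *\<^sub>v col S j) $ k = (\<Sum>l\<in>{j}. S $$ (k, l) * J $$ (l, j))"
          unfolding e[OF k] using j False Ji(1)[of _ j] by (intro sum.mono_neutral_right) auto
        then show ?thesis by (simp add: a_def)
      qed
      then have "T *\<^sub>v col S j = a j \<cdot>\<^sub>v col S j"
        using T S j by (intro eq_vecI) (auto simp del: index_mult_mat_vec)
      then show ?thesis by auto
    qed
  qed
  show thesis by (rule that[OF S R SR RS chain])
qed

lemma invertible_col_nonzero:
  fixes S :: "complex mat"
  assumes S: "S \<in> carrier_mat d d" and R: "R \<in> carrier_mat d d" and RS: "R * S = 1\<^sub>m d" and j: "j < d"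
  shows "col S j \<noteq> 0\<^sub>v d"
proof
  assume 0: "col S j = 0\<^sub>v d"
  have "unit_vec d j = col (R * S) j" using RS j by simp
  also have "\<dots> = R *\<^sub>v 0\<^sub>v d" unfolding col_mult2[OF R S j] 0 ..
  also have "\<dots> = 0\<^sub>v d" using R by (intro eq_vecI) auto
  finally show False using j by simp
qed

subsection \<open>Orbits of power bounded matrices\<close>

lemma pow_mat_Suc_mult_vec:
  fixes T :: "complex mat"
  assumes T: "T \<in> carrier_mat d d" and v: "v \<in> carrier_vec d"
  shows "T ^\<^sub>m Suc n *\<^sub>v v = T ^\<^sub>m n *\<^sub>v (T *\<^sub>v v)"
  using assms by (simp add: assoc_mult_mat_vec[of _ d d])

lemma pow_mat_eigenvector:
  fixes T :: "complex mat"
  assumes T: "T \<in> carrier_mat d d" and v: "v \<in> carrier_vec d" and ev: "T *\<^sub>v v = a \<cdot>\<^sub>v v"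
  shows "T ^\<^sub>m n *\<^sub>v v = a ^ n \<cdot>\<^sub>v v"
proof (induct n)
  case 0 then show ?case using T v by simp
next
  case (Suc n)
  have "T ^\<^sub>m Suc n *\<^sub>v v = a \<cdot>\<^sub>v (T ^\<^sub>m n *\<^sub>v v)"
    unfolding pow_mat_Suc_mult_vec[OF T v] ev using T v by (simp add: mult_mat_vec[of _ d d])
  then show ?case using Suc by (simp add: smult_smult_assoc)
qed

lemma power_bounded_orbit:
  assumes T: "T \<in> carrier_mat d d" and pb: "power_bounded d T" and v: "v \<in> carrier_vec d"
  obtains C where "\<And>n k. k < d \<Longrightarrow> cmod ((T ^\<^sub>m n *\<^sub>v v) $ k) \<le> C"
proof -
  obtain C where C: "\<And>n. op_norm d (T ^\<^sub>m n) \<le> C" using pb unfolding power_bounded_def by auto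
  have Tn: "T ^\<^sub>m n \<in> carrier_mat d d" for n using T by simp
  have "cmod ((T ^\<^sub>m n *\<^sub>v v) $ k) \<le> (\<Sum>j<d. C * cmod (v $ j))" if "k < d" for n k
  proof -
    have "cmod ((T ^\<^sub>m n *\<^sub>v v) $ k) \<le> (\<Sum>j<d. cmod ((T ^\<^sub>m n) $$ (k, j)) * cmod (v $ j))"
      using that by (simp add: mult_mat_vec_index_sum[OF Tn v] norm_mult sum_norm_le del: index_mult_mat_vec)
    also have "\<dots> \<le> (\<Sum>j<d. C * cmod (v $ j))"
      using that order_trans[OF cmod_index_le_op_norm[OF Tn] C] by (intro sum_mono mult_right_mono) auto
    finally show ?thesis .
  qed
  then show thesis by (rule that)
qed

lemma bounded_powers_cmod_le_1:
  fixes a :: complex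
  assumes bd: "\<And>n. cmod (a ^ n * c) \<le> C" and "c \<noteq> 0"
  shows "cmod a \<le> 1"
proof (rule ccontr)
  assume "\<not> ?thesis"
  then obtain n where "C / cmod c < cmod a ^ n" using real_arch_pow[of "cmod a" "C / cmod c"] by auto
  then have "C < cmod (a ^ n * c)" using \<open>c \<noteq> 0\<close> by (simp add: norm_mult norm_power field_simps)
  then show False using bd[of n] by simp
qed

text \<open>A linear contraction with vanishing forcing forgets its start. It carries the decay of
  an orbit from one member of a Jordan chain to the next.\<close>

lemma contraction_recurrence_tendsto_0:
  fixes y z :: "nat \<Rightarrow> complex"
  assumes rec: "\<And>n. y (Suc n) = a * y n + z n" and z: "z \<longlonglongrightarrow> 0" and a: "cmod a < 1"
  shows "y \<longlonglongrightarrow> 0"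
proof (rule LIMSEQ_I)
  fix e :: real assume e: "e > 0"
  \<comment> \<open>This threshold for \<open>z\<close> makes \<open>e / 2\<close> a fixed point of
    \<open>t \<mapsto> cmod a * t + (1 - cmod a) * (e / 2)\<close>, so the bound below survives each
    step of the recurrence.\<close>
  have e': "(1 - cmod a) * (e / 2) > 0" using a e by simp
  then obtain N where N: "\<And>n. n \<ge> N \<Longrightarrow> cmod (z n) < (1 - cmod a) * (e / 2)"
    using LIMSEQ_D[OF z e'] by auto
  have bound: "cmod (y (N + k)) \<le> cmod a ^ k * cmod (y N) + e / 2" for k
  proof (induct k)
    case 0 then show ?case using e by simp
  next
    case (Suc k)
    have "cmod (y (N + Suc k)) \<le> cmod a * cmod (y (N + k)) + cmod (z (N + k))"
      using norm_triangle_ineq[of "a * y (N + k)" "z (N + k)"] by (simp add: rec norm_mult)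
    also have "\<dots> \<le> cmod a * (cmod a ^ k * cmod (y N) + e / 2) + (1 - cmod a) * (e / 2)"
      using Suc N[of "N + k"] by (intro add_mono mult_left_mono) auto
    also have "\<dots> = cmod a ^ Suc k * cmod (y N) + e / 2" by (simp add: field_simps)
    finally show ?case .
  qed
  have "(\<lambda>k. cmod a ^ k * cmod (y N)) \<longlonglongrightarrow> 0"
    using LIMSEQ_power_zero[of "cmod a"] a by (intro tendsto_mult_left_zero) auto
  then obtain K where K: "\<And>k. k \<ge> K \<Longrightarrow> cmod a ^ k * cmod (y N) < e / 2"
    using LIMSEQ_D[of "\<lambda>k. cmod a ^ k * cmod (y N)" 0 "e / 2"] e by auto
  have "cmod (y n) < e" if "n \<ge> N + K" for n
    using bound[of "n - N"] K[of "n - N"] that by fastforce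
  then show "\<exists>no. \<forall>n\<ge>no. norm (y n - 0) < e" by auto
qed

lemma power_bounded_eigenvalue_le_1:
  assumes T: "T \<in> carrier_mat d d" and pb: "power_bounded d T"
    and v: "v \<in> carrier_vec d" "v \<noteq> 0\<^sub>v d" and ev: "T *\<^sub>v v = a \<cdot>\<^sub>v v"
  shows "cmod a \<le> 1"
proof -
  obtain k where k: "k < d" "v $ k \<noteq> 0" using v by (metis carrier_vecD eq_vecI index_zero_vec)
  obtain C where C: "\<And>n k. k < d \<Longrightarrow> cmod ((T ^\<^sub>m n *\<^sub>v v) $ k) \<le> C"
    using power_bounded_orbit[OF T pb v(1)] by blast
  show ?thesis
    using C[OF k(1)] k v(1) bounded_powers_cmod_le_1[of a "v $ k" C]
    by (simp add: pow_mat_eigenvector[OF T v(1) ev])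
qed

lemma pow_mat_chain_index:
  fixes T :: "complex mat"
  assumes T: "T \<in> carrier_mat d d" and v: "v \<in> carrier_vec d" and u: "u \<in> carrier_vec d"
    and chain: "T *\<^sub>v v = a \<cdot>\<^sub>v v + u" and k: "k < d"
  shows "(T ^\<^sub>m Suc n *\<^sub>v v) $ k = a * (T ^\<^sub>m n *\<^sub>v v) $ k + (T ^\<^sub>m n *\<^sub>v u) $ k"
proof -
  have Tn: "T ^\<^sub>m n \<in> carrier_mat d d" using T by simp
  have "T ^\<^sub>m Suc n *\<^sub>v v = a \<cdot>\<^sub>v (T ^\<^sub>m n *\<^sub>v v) + T ^\<^sub>m n *\<^sub>v u"
    unfolding pow_mat_Suc_mult_vec[OF T v] chain
    using mult_add_distrib_mat_vec[OF Tn, of "a \<cdot>\<^sub>v v" u] mult_mat_vec[OF Tn v] u v by simp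
  then show ?thesis
    using k carrier_vecD[OF mult_mat_vec_carrier[OF Tn u]] carrier_vecD[OF mult_mat_vec_carrier[OF Tn v]]
    by (simp del: index_mult_mat_vec pow_mat.simps dim_mult_mat_vec)
qed

text \<open>A genuine Jordan chain at a unimodular eigenvalue would make an orbit grow linearly.\<close>

lemma power_bounded_unimodular_chain:
  assumes T: "T \<in> carrier_mat d d" and pb: "power_bounded d T"
    and v: "v \<in> carrier_vec d" and u: "u \<in> carrier_vec d"
    and chain: "T *\<^sub>v v = a \<cdot>\<^sub>v v + u" and ev: "T *\<^sub>v u = a \<cdot>\<^sub>v u" and a: "cmod a = 1"
  shows "u = 0\<^sub>v d"
proof (rule ccontr)
  assume "u \<noteq> 0\<^sub>v d"
  then obtain k where k: "k < d" "u $ k \<noteq> 0" using u by (metis carrier_vecD eq_vecI index_zero_vec)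
  obtain C where C: "\<And>n k. k < d \<Longrightarrow> cmod ((T ^\<^sub>m n *\<^sub>v v) $ k) \<le> C"
    using power_bounded_orbit[OF T pb v] by blast
  \<comment> \<open>The extra factor \<open>a\<close> on the left avoids the exponent n - 1 in T^n v
    = a^n v + n a^(n-1) u.\<close>
  have orbit: "a * (T ^\<^sub>m n *\<^sub>v v) $ k = a ^ n * (a * v $ k + of_nat n * u $ k)" for n
  proof (induct n)
    case 0 then show ?case using T v by simp
  next
    case (Suc n)
    have "(T ^\<^sub>m n *\<^sub>v u) $ k = a ^ n * u $ k"
      using pow_mat_eigenvector[OF T u ev] u k by simp
    then show ?case
      using Suc pow_mat_chain_index[OF T v u chain k(1), of n] by (simp add: algebra_simps)
  qed
  have "real n * cmod (u $ k) \<le> C + cmod (v $ k)" for n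
  proof -
    have "real n * cmod (u $ k) = cmod ((a * v $ k + of_nat n * u $ k) - a * v $ k)"
      by (simp add: norm_mult)
    also have "\<dots> \<le> cmod (a * v $ k + of_nat n * u $ k) + cmod (a * v $ k)"
      by (rule norm_triangle_ineq4)
    also have "cmod (a * v $ k + of_nat n * u $ k) = cmod (a * (T ^\<^sub>m n *\<^sub>v v) $ k)"
      unfolding orbit using a by (simp add: norm_mult norm_power)
    also have "\<dots> \<le> C" using C[OF k(1)] a by (simp add: norm_mult)
    finally show ?thesis using a by (simp add: norm_mult)
  qed
  moreover obtain n where "real n > (C + cmod (v $ k)) / cmod (u $ k)" using reals_Archimedean2 by blast
  ultimately show False using k(2) by (simp add: field_simps not_less[symmetric])
qed


text \<open>Strong induction climbs the chains. If column \<open>j\<close> is not an eigenvector,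
  its predecessor has the same eigenvalue: in the unimodular case that predecessor is an eigenvector
  and would have to vanish, contradicting invertibility; otherwise its orbit decays and drives the
  contraction recurrence for column \<open>j\<close>.\<close>

lemma power_bounded_chain_dichotomy:
  assumes T: "T \<in> carrier_mat d d" and pb: "power_bounded d T"
    and S: "S \<in> carrier_mat d d" and R: "R \<in> carrier_mat d d" and RS: "R * S = 1\<^sub>m d"
    and chain: "\<And>j. j < d \<Longrightarrow> T *\<^sub>v col S j = a j \<cdot>\<^sub>v col S j \<or>
      (\<exists>i. j = Suc i \<and> a i = a j \<and> T *\<^sub>v col S j = a j \<cdot>\<^sub>v col S j + col S i)"
  shows "j < d \<Longrightarrow> cmod (a j) = 1 \<and> T *\<^sub>v col S j = a j \<cdot>\<^sub>v col S j \<or>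
    cmod (a j) < 1 \<and> (\<forall>k<d. (\<lambda>n. (T ^\<^sub>m n *\<^sub>v col S j) $ k) \<longlonglongrightarrow> 0)"
proof (induct j rule: less_induct)
  case (less j)
  have cS: "col S k \<in> carrier_vec d" for k using S by auto
  note nz = invertible_col_nonzero[OF S R RS]
  show ?case
  proof (cases "T *\<^sub>v col S j = a j \<cdot>\<^sub>v col S j")
    case ev: True
    have "cmod (a j) \<le> 1"
      using power_bounded_eigenvalue_le_1[OF T pb cS nz[OF less(2)] ev] .
    moreover have "(\<lambda>n. (T ^\<^sub>m n *\<^sub>v col S j) $ k) \<longlonglongrightarrow> 0" if "cmod (a j) < 1" "k < d" for k
      using that tendsto_mult_left_zero[OF LIMSEQ_power_zero[of "a j"]] S
      by (simp add: pow_mat_eigenvector[OF T cS ev])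
    ultimately show ?thesis using ev by fastforce
  next
    case False
    then obtain i where i: "j = Suc i" "a i = a j"
      and ch: "T *\<^sub>v col S j = a j \<cdot>\<^sub>v col S j + col S i" using chain[OF less(2)] by auto
    have id: "i < j" "i < d" using i(1) less(2) by auto
    from less(1)[OF id] show ?thesis
    proof
      assume *: "cmod (a i) = 1 \<and> T *\<^sub>v col S i = a i \<cdot>\<^sub>v col S i"
      have "col S i = 0\<^sub>v d"
        by (rule power_bounded_unimodular_chain[OF T pb cS cS ch]) (use * i in simp_all)
      then show ?thesis using nz[OF id(2)] by simp
    next
      assume *: "cmod (a i) < 1 \<and> (\<forall>k<d. (\<lambda>n. (T ^\<^sub>m n *\<^sub>v col S i) $ k) \<longlonglongrightarrow> 0)"
      have "(\<lambda>n. (T ^\<^sub>m n *\<^sub>v col S j) $ k) \<longlonglongrightarrow> 0" if k: "k < d" for k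
        by (rule contraction_recurrence_tendsto_0[where y = "\<lambda>n. (T ^\<^sub>m n *\<^sub>v col S j) $ k"
              and z = "\<lambda>n. (T ^\<^sub>m n *\<^sub>v col S i) $ k", OF pow_mat_chain_index[OF T cS cS ch k]])
          (use * k i in simp_all)
      then show ?thesis using * i by simp
    qed
  qed
qed

section \<open>Limits of the Gram matrices of powers\<close>

lemma cscalar_prod_tendsto_0:
  fixes x y :: "nat \<Rightarrow> complex vec"
  assumes x: "\<And>n. x n \<in> carrier_vec d" and y: "\<And>n. y n \<in> carrier_vec d"
    and lim: "\<And>k. k < d \<Longrightarrow> (\<lambda>n. x n $ k) \<longlonglongrightarrow> 0" and bd: "\<And>n k. k < d \<Longrightarrow> cmod (y n $ k) \<le> C"
  shows "(\<lambda>n. x n \<bullet>c y n) \<longlonglongrightarrow> 0" "(\<lambda>n. y n \<bullet>c x n) \<longlonglongrightarrow> 0"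
proof -
  have "(\<lambda>n. x n $ k * cnj (y n $ k)) \<longlonglongrightarrow> 0" if k: "k < d" for k
    by (rule tendsto_0_le[OF lim[OF k], where K = C])
      (use bd[OF k] in \<open>auto simp: norm_mult intro!: always_eventually mult_left_mono\<close>)
  then show lim_xy: "(\<lambda>n. x n \<bullet>c y n) \<longlonglongrightarrow> 0"
    unfolding cscalar_prod_eq_sum[OF y] by (intro tendsto_null_sum) auto
  show "(\<lambda>n. y n \<bullet>c x n) \<longlonglongrightarrow> 0"
    unfolding cscalar_prod_cnj[OF x y] using tendsto_cnj[OF lim_xy] by simp
qed

text \<open>The order of the two columns is reversed because \<open>\<bullet>c\<close> conjugates
  its second argument.\<close>

lemma adjoint_mult_index:
  fixes X Y :: "complex mat"
  assumes "X \<in> carrier_mat n m" "Y \<in> carrier_mat n k" "i < m" "j < k"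
  shows "(mat_adjoint X * Y) $$ (i, j) = col Y j \<bullet>c col X i"
  using assms
  by (auto simp: scalar_prod_def intro!: sum.cong)

lemma gram_carrier:
  fixes X :: "complex mat"
  shows "X \<in> carrier_mat n m \<Longrightarrow> mat_adjoint X * X \<in> carrier_mat m m"
  by (rule mult_carrier_mat[OF mat_adjoint_carrier])

text \<open>Delivering the idempotent together with the limit lets one lemma serve both the
  convergence criterion and the inclusion of the limits in the set of Gram matrices of
  idempotents.\<close>

lemma orbit_gram_tendsto:
  assumes T: "T \<in> carrier_mat d d" and pb: "power_bounded d T"
    and orth: "\<And>l m v w. eigenvalue T l \<Longrightarrow> eigenvalue T m \<Longrightarrow> cmod l = 1 \<Longrightarrow> cmod m = 1 \<Longrightarrow>
          l \<noteq> m \<Longrightarrow> v \<in> carrier_vec d \<Longrightarrow> w \<in> carrier_vec d \<Longrightarrow>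
          T *\<^sub>v v = l \<cdot>\<^sub>v v \<Longrightarrow> T *\<^sub>v w = m \<cdot>\<^sub>v w \<Longrightarrow> v \<bullet>c w = 0"
  obtains P where "P \<in> carrier_mat d d" "P * P = P"
    "mat_tendsto d (\<lambda>n. mat_adjoint (T ^\<^sub>m n) * T ^\<^sub>m n) (mat_adjoint P * P)"
proof -
  obtain S R a where S: "S \<in> carrier_mat d d" and R: "R \<in> carrier_mat d d"
    and SR: "S * R = 1\<^sub>m d" and RS: "R * S = 1\<^sub>m d"
    and chain: "\<And>j. j < d \<Longrightarrow> T *\<^sub>v col S j = a j \<cdot>\<^sub>v col S j \<or>
      (\<exists>i. j = Suc i \<and> a i = a j \<and> T *\<^sub>v col S j = a j \<cdot>\<^sub>v col S j + col S i)"
    by (rule jordan_chains[OF T]) blast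
  have dich: "cmod (a j) = 1 \<and> T *\<^sub>v col S j = a j \<cdot>\<^sub>v col S j \<or>
      cmod (a j) < 1 \<and> (\<forall>k<d. (\<lambda>n. (T ^\<^sub>m n *\<^sub>v col S j) $ k) \<longlonglongrightarrow> 0)" if "j < d" for j
    by (rule power_bounded_chain_dichotomy[OF T pb S R RS _ that]) (rule chain)
  \<comment> \<open>\<open>D\<close> selects the unimodular indices, so \<open>P\<close> is the
    projection onto the span of their columns of \<open>S\<close>, along the span of the decaying
    columns.\<close>
  define D :: "complex mat" where "D = mat_diag d (\<lambda>j. if cmod (a j) = 1 then 1 else 0)"
  define P where "P = S * D * R"
  have D: "D \<in> carrier_mat d d" and DD: "D * D = D"
    unfolding D_def by (auto intro!: arg_cong[where f = "mat_diag d"])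
  have P: "P \<in> carrier_mat d d" unfolding P_def using S D R by simp
  note assoc = assoc_mult_mat[of _ d d _ d _ d] and cm = mult_carrier_mat[of _ d d _ d]
  have PS: "P * S = S * D"
  proof -
    have "P * S = S * D * (R * S)" unfolding P_def using S D R by (simp add: assoc)
    then show ?thesis unfolding RS using S D by simp
  qed
  have PP: "P * P = P"
  proof -
    have "P * P = (P * S) * (D * R)" unfolding P_def using S D R by (simp add: assoc)
    also have "\<dots> = S * (D * D) * R" unfolding PS using S D R by (simp add: assoc)
    finally show ?thesis unfolding DD P_def .
  qed
  have colPS: "col (P * S) j = (if cmod (a j) = 1 then col S j else 0\<^sub>v d)" if "j < d" for j
    unfolding PS D_def using S that
    by (auto simp: mat_diag_mult_right[OF S] intro!: eq_vecI)
  have cS: "col S k \<in> carrier_vec d" for k using S by auto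
  have Tn: "T ^\<^sub>m n \<in> carrier_mat d d" for n using T by simp
  have ev: "eigenvalue T (a j)" if "j < d" "cmod (a j) = 1" for j
    using dich[OF that(1)] that cS[of j] invertible_col_nonzero[OF S R RS that(1)] T
    unfolding eigenvalue_def eigenvector_def by auto
  have lim: "(\<lambda>n. (T ^\<^sub>m n *\<^sub>v col S j) \<bullet>c (T ^\<^sub>m n *\<^sub>v col S i)) \<longlonglongrightarrow> col (P * S) j \<bullet>c col (P * S) i"
    if ij: "i < d" "j < d" for i j
  proof (cases "cmod (a i) = 1 \<and> cmod (a j) = 1")
    case True
    then have evs: "T *\<^sub>v col S i = a i \<cdot>\<^sub>v col S i" "T *\<^sub>v col S j = a j \<cdot>\<^sub>v col S j"
      using dich[OF ij(1)] dich[OF ij(2)] by auto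
    \<comment> \<open>For two unimodular columns the product does not depend on \<open>n\<close>:
      either the eigenvalues agree and the factor \<open>(a j * cnj (a i)) ^ n\<close> is 1, or
      orthogonality makes the product 0.\<close>
    have "(T ^\<^sub>m n *\<^sub>v col S j) \<bullet>c (T ^\<^sub>m n *\<^sub>v col S i) = col S j \<bullet>c col S i" for n
    proof -
      have "(T ^\<^sub>m n *\<^sub>v col S j) \<bullet>c (T ^\<^sub>m n *\<^sub>v col S i) = (a j * cnj (a i)) ^ n * (col S j \<bullet>c col S i)"
        by (simp add: pow_mat_eigenvector[OF T cS evs(1)] pow_mat_eigenvector[OF T cS evs(2)]
            cscalar_prod_smult[of _ d] cS power_mult_distrib)
      moreover have "a j * cnj (a i) = 1" if "a i = a j"
        using True that by (simp add: complex_norm_square[symmetric])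
      moreover have "col S j \<bullet>c col S i = 0" if "a i \<noteq> a j"
        using orth[OF ev ev _ _ _ cS cS evs(2) evs(1)] ij True that by auto
      ultimately show ?thesis by (cases "a i = a j") auto
    qed
    then show ?thesis using True ij by (simp add: colPS)
  next
    case False
    then have zero: "col (P * S) j \<bullet>c col (P * S) i = 0" using ij cS by (auto simp: colPS)
    have decay: "\<And>k. k < d \<Longrightarrow> (\<lambda>n. (T ^\<^sub>m n *\<^sub>v col S m) $ k) \<longlonglongrightarrow> 0" if "m < d" "cmod (a m) \<noteq> 1" for m
      using dich[OF that(1)] that(2) by auto
    have c: "T ^\<^sub>m n *\<^sub>v col S m \<in> carrier_vec d" for n m
      by (rule mult_mat_vec_carrier[OF Tn cS])
    obtain Ci where Ci: "\<And>n k. k < d \<Longrightarrow> cmod ((T ^\<^sub>m n *\<^sub>v col S i) $ k) \<le> Ci"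
      using power_bounded_orbit[OF T pb cS] by blast
    obtain Cj where Cj: "\<And>n k. k < d \<Longrightarrow> cmod ((T ^\<^sub>m n *\<^sub>v col S j) $ k) \<le> Cj"
      using power_bounded_orbit[OF T pb cS] by blast
    \<comment> \<open>At least one of the two orbits decays and the other is bounded, so the product
      tends to 0.\<close>
    show ?thesis
    proof (cases "cmod (a j) = 1")
      case True
      then have "cmod (a i) \<noteq> 1" using False by simp
      then show ?thesis unfolding zero
        by (rule cscalar_prod_tendsto_0(2)[OF c c decay[OF ij(1)] Cj])
    next
      case False
      then show ?thesis unfolding zero
        by (rule cscalar_prod_tendsto_0(1)[OF c c decay[OF ij(2)] Ci])
    qed
  qed
  \<comment> \<open>With \<open>X\<close> a power of \<open>T\<close> or the idempotent
    \<open>P\<close>, this expresses the Gram matrix in the Jordan basis by the inner products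
    treated in \<open>lim\<close>.\<close>
  have gram: "mat_adjoint S * (mat_adjoint X * X) * S = mat_adjoint (X * S) * (X * S)"
    if "X \<in> carrier_mat d d" for X
    using that S by (simp add: mat_adjoint_mult[OF that S] assoc cm)
  have "mat_tendsto d (\<lambda>n. mat_adjoint S * (mat_adjoint (T ^\<^sub>m n) * T ^\<^sub>m n) * S)
      (mat_adjoint S * (mat_adjoint P * P) * S)"
  proof (subst mat_tendsto_iff_entrywise, goal_cases)
    case 1 show ?case using S gram_carrier[OF Tn] by (simp add: cm)
  next
    case 2
    have "(\<lambda>n. (mat_adjoint (T ^\<^sub>m n * S) * (T ^\<^sub>m n * S)) $$ (i, j))
        \<longlonglongrightarrow> (mat_adjoint (P * S) * (P * S)) $$ (i, j)" if ij: "i < d" "j < d" for i j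
    proof -
      have "(mat_adjoint (T ^\<^sub>m n * S) * (T ^\<^sub>m n * S)) $$ (i, j) =
          (T ^\<^sub>m n *\<^sub>v col S j) \<bullet>c (T ^\<^sub>m n *\<^sub>v col S i)" for n
        using adjoint_mult_index[of "T ^\<^sub>m n * S" d d "T ^\<^sub>m n * S" d i j] Tn[of n] S ij
        by (simp only: mult_carrier_mat[of _ d d] col_mult2[of _ d d])
      moreover have "(mat_adjoint (P * S) * (P * S)) $$ (i, j) = col (P * S) j \<bullet>c col (P * S) i"
        using adjoint_mult_index[of "P * S" d d "P * S" d i j] P S ij by simp
      ultimately show ?thesis using lim[OF ij] by (simp only:)
    qed
    then show ?case using S P by (simp only: gram[OF Tn] gram[OF P]) (simp add: cm)
  qed
  \<comment> \<open>Congruence with \<open>R\<close>, the inverse of \<open>S\<close>, undoes the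
    change of basis.\<close>
  from mat_tendsto_congruence[OF _ _ R this, of "mat_adjoint R"]
  have "mat_tendsto d (\<lambda>n. mat_adjoint R * (mat_adjoint S * (mat_adjoint (T ^\<^sub>m n) * T ^\<^sub>m n) * S) * R)
      (mat_adjoint R * (mat_adjoint S * (mat_adjoint P * P) * S) * R)"
    using R S gram_carrier[OF Tn] by (simp add: cm)
  moreover have "mat_adjoint R * (mat_adjoint S * Y * S) * R = Y" if "Y \<in> carrier_mat d d" for Y
  proof -
    have "mat_adjoint R * (mat_adjoint S * Y * S) * R = (mat_adjoint R * mat_adjoint S) * Y * (S * R)"
      using that R S by (simp add: assoc cm)
    also have "mat_adjoint R * mat_adjoint S = 1\<^sub>m d"
      using mat_adjoint_mult[OF S R] unfolding SR by simp
    finally show ?thesis using that SR by simp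
  qed
  ultimately have "mat_tendsto d (\<lambda>n. mat_adjoint (T ^\<^sub>m n) * T ^\<^sub>m n) (mat_adjoint P * P)"
    using gram_carrier[OF Tn] gram_carrier[OF P] by simp
  then show thesis using that P PP by blast
qed

text \<open>Shifting the index gives \<open>z * L = L\<close>, while all terms have modulus
  \<open>cmod c\<close>, so \<open>L\<close> is nonzero and can be cancelled.\<close>

lemma unimodular_power_limit:
  fixes z :: complex
  assumes z: "cmod z = 1" and lim: "(\<lambda>n. z ^ n * c) \<longlonglongrightarrow> L" and c: "c \<noteq> 0"
  shows "z = 1"
proof -
  have "(\<lambda>n. z * (z ^ n * c)) \<longlonglongrightarrow> z * L" by (intro tendsto_intros lim)
  moreover have "(\<lambda>n. z ^ Suc n * c) \<longlonglongrightarrow> L" using LIMSEQ_Suc[OF lim] .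
  ultimately have "z * L = L" using LIMSEQ_unique by (fastforce simp: mult.assoc)
  moreover have "L \<noteq> 0"
  proof
    assume "L = 0"
    then have "(\<lambda>n. cmod (z ^ n * c)) \<longlonglongrightarrow> 0" using tendsto_norm[OF lim] by simp
    then show False using z c by (simp add: norm_mult norm_power LIMSEQ_const_iff)
  qed
  ultimately show ?thesis by simp
qed

lemma gram_limit_orthogonal:
  assumes T: "T \<in> carrier_mat d d"
    and lim: "mat_tendsto d (\<lambda>n. mat_adjoint (T ^\<^sub>m n) * T ^\<^sub>m n) L"
    and lm: "cmod l = 1" "cmod m = 1" "l \<noteq> m"
    and v: "v \<in> carrier_vec d" and w: "w \<in> carrier_vec d"
    and ev: "T *\<^sub>v v = l \<cdot>\<^sub>v v" "T *\<^sub>v w = m \<cdot>\<^sub>v w"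
  shows "v \<bullet>c w = 0"
proof (rule ccontr)
  assume nz: "v \<bullet>c w \<noteq> 0"
  have Tn: "T ^\<^sub>m n \<in> carrier_mat d d" for n using T by simp
  define M where "M n = mat_adjoint (T ^\<^sub>m n) * T ^\<^sub>m n" for n
  have M: "M n \<in> carrier_mat d d" for n unfolding M_def by (rule gram_carrier[OF Tn])
  have L: "L \<in> carrier_mat d d" using lim by (simp add: mat_tendsto_def)
  \<comment> \<open>Written out as a finite sum, the sesquilinear form visibly passes to the
    entrywise limit.\<close>
  have e: "(X *\<^sub>v v) \<bullet>c w = (\<Sum>i<d. (\<Sum>j<d. X $$ (i, j) * v $ j) * cnj (w $ i))"
    if "X \<in> carrier_mat d d" for X
    by (simp add: cscalar_prod_eq_sum[OF w] mult_mat_vec_index_sum[OF that v] del: index_mult_mat_vec)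
  have "(\<lambda>n. (M n *\<^sub>v v) \<bullet>c w) \<longlonglongrightarrow> (L *\<^sub>v v) \<bullet>c w"
    unfolding e[OF M] e[OF L]
    using lim[folded M_def, unfolded mat_tendsto_iff_entrywise[OF M]] by (intro tendsto_intros) auto
  moreover have "(M n *\<^sub>v v) \<bullet>c w = (l * cnj m) ^ n * (v \<bullet>c w)" for n
  proof -
    have "(M n *\<^sub>v v) \<bullet>c w = (mat_adjoint (T ^\<^sub>m n) *\<^sub>v (T ^\<^sub>m n *\<^sub>v v)) \<bullet>c w"
      unfolding M_def by (simp only: assoc_mult_mat_vec[OF mat_adjoint_carrier[OF Tn] Tn v])
    also have "\<dots> = (T ^\<^sub>m n *\<^sub>v v) \<bullet>c (T ^\<^sub>m n *\<^sub>v w)"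
      using cscalar_prod_adjoint[of "mat_adjoint (T ^\<^sub>m n)" d d "T ^\<^sub>m n *\<^sub>v v" w] Tn[of n] v w
      by (simp add: mult_mat_vec_carrier[of _ d d])
    also have "\<dots> = (l * cnj m) ^ n * (v \<bullet>c w)"
      by (simp add: pow_mat_eigenvector[OF T v ev(1)] pow_mat_eigenvector[OF T w ev(2)]
            cscalar_prod_smult[of _ d] v w power_mult_distrib)
    finally show ?thesis .
  qed
  ultimately have "l * cnj m = 1"
    using lm nz by (intro unimodular_power_limit[of _ "v \<bullet>c w"]) (auto simp: norm_mult)
  \<comment> \<open>Comparing with \<open>l * cnj m = 1\<close> and cancelling \<open>cnj m\<close>
    gives \<open>l = m\<close>.\<close>
  moreover have "m * cnj m = 1" using lm(2) by (simp add: complex_norm_square[symmetric])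
  ultimately show False using lm(3) by (metis mult_cancel_right mult_zero_right zero_neq_one)
qed


subsection \<open>Independent columns\<close>

abbreviation vec_span :: "nat \<Rightarrow> 'a :: field vec set \<Rightarrow> 'a vec set" where
  "vec_span n \<equiv> LinearCombinations.module.span class_ring (module_vec TYPE('a) n)"

abbreviation vec_lin_dep :: "nat \<Rightarrow> 'a :: field vec set \<Rightarrow> bool" where
  "vec_lin_dep n \<equiv> LinearCombinations.module.lin_dep class_ring (module_vec TYPE('a) n)"

lemmas vec_finite_lin_dep =
  LinearCombinations.module.finite_lin_dep[OF vec_module, unfolded module_vec_simps class_ring_simps]

lemmas vec_finite_span =
  LinearCombinations.module.finite_span[OF vec_module, unfolded module_vec_simps class_ring_simps]

lemmas vec_dim_span = vectorspace.dim_span[OF vec_vs, unfolded module_vec_simps class_ring_simps]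

lemma mult_mat_vec_supported_index:
  fixes W :: "'a :: field mat"
  assumes W: "W \<in> carrier_mat n m" and I: "I \<subseteq> {..<m}" and inj: "inj_on (col W) I" and k: "k < n"
  shows "(W *\<^sub>v vec m (\<lambda>i. if i \<in> I then a (col W i) else 0)) $ k = (\<Sum>x\<in>col W ` I. a x * x $ k)"
proof -
  have "(W *\<^sub>v vec m (\<lambda>i. if i \<in> I then a (col W i) else 0)) $ k =
      (\<Sum>i<m. if i \<in> I then a (col W i) * col W i $ k else 0)"
    unfolding mult_mat_vec_index_sum[OF W vec_carrier k] using W k by (intro sum.cong) auto
  also have "\<dots> = (\<Sum>i\<in>I. a (col W i) * col W i $ k)"
    using I by (simp add: sum.inter_restrict[symmetric] Int_absorb1)
  finally show ?thesis by (simp add: sum.reindex[OF inj])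
qed

text \<open>Module combinations take coefficients indexed by vectors, matrices take them indexed by
  column numbers. Injectivity of \<open>col W\<close> on \<open>I\<close> makes the two descriptions
  match.\<close>

lemma mult_mat_vec_supported_lincomb:
  fixes W :: "'a :: field mat"
  assumes W: "W \<in> carrier_mat n m" and I: "I \<subseteq> {..<m}" and inj: "inj_on (col W) I"
  shows "W *\<^sub>v vec m (\<lambda>i. if i \<in> I then a (col W i) else 0) =
    LinearCombinations.module.lincomb (module_vec TYPE('a) n) a (col W ` I)"
proof -
  have X: "col W ` I \<subseteq> carrier_vec n" and fin: "finite (col W ` I)"
    using W I finite_subset[OF I] by auto
  show ?thesis
    using W vec_space.lincomb_dim[OF fin X] vec_space.lincomb_index[OF _ X]
      mult_mat_vec_supported_index[OF W I inj]
    by (intro eq_vecI) (auto simp del: index_mult_mat_vec)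
qed

text \<open>Linear dependence is a property of a set of vectors and does not see repeated columns,
  so distinctness is shown separately: equal columns \<open>i\<close> and \<open>j\<close> would put
  the difference of two unit vectors into the kernel.\<close>

lemma cols_lin_indpt:
  fixes W :: "'a :: field mat"
  assumes W: "W \<in> carrier_mat n m" and I: "I \<subseteq> {..<m}"
    and ker: "\<And>c. c \<in> carrier_vec m \<Longrightarrow> (\<And>i. i < m \<Longrightarrow> i \<notin> I \<Longrightarrow> c $ i = 0) \<Longrightarrow>
      W *\<^sub>v c = 0\<^sub>v n \<Longrightarrow> c = 0\<^sub>v m"
  shows "inj_on (col W) I"
    and "\<not> vec_lin_dep n (col W ` I)"
proof -
  show inj: "inj_on (col W) I"
  proof (rule inj_onI, rule ccontr)
    fix i j assume ij: "i \<in> I" "j \<in> I" "col W i = col W j" "i \<noteq> j"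
    then have lt: "i < m" "j < m" using I by auto
    let ?c = "unit_vec m i - unit_vec m j :: 'a vec"
    have "W *\<^sub>v ?c = W *\<^sub>v unit_vec m i - W *\<^sub>v unit_vec m j"
      by (rule mult_minus_distrib_mat_vec[OF W]) auto
    also have "W *\<^sub>v unit_vec m i = W *\<^sub>v unit_vec m j"
    proof -
      have "W *\<^sub>v unit_vec m l = col W l" if "l < m" for l
        using W that by (intro eq_vecI) auto
      then show ?thesis using lt ij(3) by simp
    qed
    also have "W *\<^sub>v unit_vec m j - W *\<^sub>v unit_vec m j = 0\<^sub>v n" using W by (intro eq_vecI) auto
    finally have "?c = 0\<^sub>v m" using ij lt by (intro ker) auto
    then have "?c $ i = 0" using lt by simp
    then show False using lt ij(4) by simp
  qed
  show "\<not> vec_lin_dep n (col W ` I)"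
  proof
    assume dep: "vec_lin_dep n (col W ` I)"
    have X: "col W ` I \<subseteq> carrier_vec n" and fin: "finite (col W ` I)"
      using W I finite_subset[OF I] by auto
    from vec_finite_lin_dep[OF fin dep X] obtain a x
      where a: "LinearCombinations.module.lincomb (module_vec TYPE('a) n) a (col W ` I) = 0\<^sub>v n" and x: "x \<in> col W ` I" "a x \<noteq> 0" by auto
    obtain i where i: "i \<in> I" "x = col W i" using x by auto
    define c where "c = vec m (\<lambda>i. if i \<in> I then a (col W i) else 0)"
    have "c = 0\<^sub>v m"
      by (rule ker) (auto simp: c_def mult_mat_vec_supported_lincomb[OF W I inj] a)
    moreover have "c $ i = a x" using i I by (auto simp: c_def)
    ultimately show False using i I x by auto
  qed
qed

lemma span_cols:
  fixes W :: "'a :: field mat"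
  assumes W: "W \<in> carrier_mat n m" and I: "I \<subseteq> {..<m}" and inj: "inj_on (col W) I"
  shows "vec_span n (col W ` I) =
    {W *\<^sub>v c | c. c \<in> carrier_vec m \<and> (\<forall>i<m. i \<notin> I \<longrightarrow> c $ i = 0)}"
proof -
  have X: "col W ` I \<subseteq> carrier_vec n" and fin: "finite (col W ` I)"
    using W I finite_subset[OF I] by auto
  have span: "vec_span n (col W ` I) =
      {LinearCombinations.module.lincomb (module_vec TYPE('a) n) a (col W ` I) | a. True}"
    unfolding vec_finite_span[OF fin X] by auto
  show ?thesis
  proof (intro equalityI subsetI)
    fix v assume "v \<in> vec_span n (col W ` I)"
    then obtain a where "v = W *\<^sub>v vec m (\<lambda>i. if i \<in> I then a (col W i) else 0)"
      unfolding span mult_mat_vec_supported_lincomb[OF W I inj] by auto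
    then show "v \<in> {W *\<^sub>v c | c. c \<in> carrier_vec m \<and> (\<forall>i<m. i \<notin> I \<longrightarrow> c $ i = 0)}" by auto
  next
    fix v assume "v \<in> {W *\<^sub>v c | c. c \<in> carrier_vec m \<and> (\<forall>i<m. i \<notin> I \<longrightarrow> c $ i = 0)}"
    then obtain c where c: "v = W *\<^sub>v c" "c \<in> carrier_vec m" "\<forall>i<m. i \<notin> I \<longrightarrow> c $ i = 0" by auto
    \<comment> \<open>The inverse of \<open>col W\<close> recovers the column number of a vector and
      so turns coordinates into a coefficient function.\<close>
    let ?a = "\<lambda>x. c $ the_inv_into I (col W) x"
    have "vec m (\<lambda>i. if i \<in> I then ?a (col W i) else 0) = c"
      using c by (intro eq_vecI) (auto simp: the_inv_into_f_f[OF inj])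
    with c(1) have "v = LinearCombinations.module.lincomb (module_vec TYPE('a) n) ?a (col W ` I)"
      using mult_mat_vec_supported_lincomb[OF W I inj, of ?a] by simp
    then show "v \<in> vec_span n (col W ` I)" unfolding span by blast
  qed
qed

lemma vec_span_eqI:
  assumes "X \<subseteq> vec_span n Y" "Y \<subseteq> X" "Y \<subseteq> carrier_vec n"
  shows "vec_span n X = vec_span n Y"
  using idom_vec.span_subsetI[OF assms(3,1)]
    LinearCombinations.module.span_is_monotone[OF vec_module assms(2)] by blast

lemma span_set_cols:
  fixes A :: "'a :: field mat"
  assumes A: "A \<in> carrier_mat n nc"
  shows "vec_span n (set (cols A)) = (\<lambda>v. A *\<^sub>v v) ` carrier_vec nc"
proof -
  have "vec_span n (set (cols A)) = {y \<in> carrier_vec n. \<exists>x\<in>carrier_vec nc. A *\<^sub>v x = y}"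
    using vec_space.col_space_eq[OF A] A unfolding vec_space.col_space_def by simp
  also have "\<dots> = (\<lambda>v. A *\<^sub>v v) ` carrier_vec nc" using mult_mat_vec_carrier[OF A] by blast
  finally show ?thesis .
qed

lemma dim_span_indpt:
  fixes B :: "'a :: field vec set"
  assumes B: "B \<subseteq> carrier_vec n" "finite B" "\<not> vec_lin_dep n B"
  shows "vectorspace.dim class_ring ((module_vec TYPE('a) n)\<lparr>carrier := vec_span n B\<rparr>) = card B"
proof -
  have "maximal B (\<lambda>T. T \<subseteq> B \<and> \<not> vec_lin_dep n T)" using B(3) unfolding maximal_def by auto
  from vec_dim_span[OF B(1,2) this] show ?thesis .
qed

text \<open>\<open>X\<close> extends to a maximal independent subset of \<open>X \<union> B\<close>.
  Both this set and \<open>B\<close> have as many elements as the dimension of the common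
  span.\<close>

lemma card_indpt_le:
  fixes B X :: "'a :: field vec set"
  assumes B: "B \<subseteq> carrier_vec n" "finite B" "\<not> vec_lin_dep n B"
    and X: "X \<subseteq> vec_span n B" "X \<subseteq> carrier_vec n" "finite X" "\<not> vec_lin_dep n X"
  shows "card X \<le> card B"
proof -
  have "B \<subseteq> vec_span n B"
    by (rule LinearCombinations.module.in_own_span[OF vec_module, unfolded module_vec_simps, OF B(1)])
  then have span: "vec_span n (X \<union> B) = vec_span n B" using X(1) B(1) by (intro vec_span_eqI) auto
  obtain M where M: "maximal M (\<lambda>T. T \<subseteq> X \<union> B \<and> \<not> vec_lin_dep n T)" "X \<subseteq> M" "finite M"
    using maximal_exists_superset[of "X \<union> B" "\<lambda>T. T \<subseteq> X \<union> B \<and> \<not> vec_lin_dep n T" X] X B by blast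
  have "card B = card M"
    using vec_dim_span[OF _ _ M(1)] dim_span_indpt[OF B] X B unfolding span by simp
  then show ?thesis using card_mono[OF M(3,2)] by simp
qed

subsection \<open>Unitary diagonalization of Hermitian matrices\<close>

lemma hermitian_cscalar_prod:
  assumes "A \<in> carrier_mat d d" "mat_adjoint A = A" "v \<in> carrier_vec d" "w \<in> carrier_vec d"
  shows "(A *\<^sub>v v) \<bullet>c w = v \<bullet>c (A *\<^sub>v (w :: complex vec))"
  using cscalar_prod_adjoint[OF assms(1,3,4)] assms(2) by simp

lemma hermitian_eigenvalue_real:
  fixes v :: "complex vec"
  assumes A: "A \<in> carrier_mat d d" "mat_adjoint A = A" and v: "v \<in> carrier_vec d" "v \<noteq> 0\<^sub>v d"
    and ev: "A *\<^sub>v v = a \<cdot>\<^sub>v v"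
  shows "cnj a = a"
proof -
  have "a * (v \<bullet>c v) = cnj a * (v \<bullet>c v)"
    using hermitian_cscalar_prod[OF A v(1) v(1)] unfolding ev
    by (simp only: cscalar_prod_smult[OF v(1) v(1)])
  moreover have "v \<bullet>c v \<noteq> 0" using v by simp
  ultimately show ?thesis by simp
qed

lemma hermitian_eigenvectors_orthogonal:
  fixes v w :: "complex vec"
  assumes A: "A \<in> carrier_mat d d" "mat_adjoint A = A"
    and v: "v \<in> carrier_vec d" and w: "w \<in> carrier_vec d"
    and ev: "A *\<^sub>v v = a \<cdot>\<^sub>v v" "A *\<^sub>v w = b \<cdot>\<^sub>v w" and ab: "a \<noteq> b"
  shows "v \<bullet>c w = 0"
proof (cases "w = 0\<^sub>v d")
  case False
  have "a * (v \<bullet>c w) = cnj b * (v \<bullet>c w)"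
    using hermitian_cscalar_prod[OF A v w] unfolding ev by (simp only: cscalar_prod_smult[OF v w])
  then show ?thesis using hermitian_eigenvalue_real[OF A w False ev(2)] ab by simp
qed (use v in simp)

text \<open>Pairing the chain relation with \<open>u\<close> and moving \<open>A\<close> to the
  other side, where \<open>a\<close> is real, leaves \<open>u \<bullet>c u = 0\<close>. Hence a
  Jordan basis of a Hermitian matrix consists of eigenvectors.\<close>

lemma hermitian_jordan_chain:
  fixes v u :: "complex vec"
  assumes A: "A \<in> carrier_mat d d" "mat_adjoint A = A"
    and v: "v \<in> carrier_vec d" and u: "u \<in> carrier_vec d"
    and ch: "A *\<^sub>v v = a \<cdot>\<^sub>v v + u" and ev: "A *\<^sub>v u = a \<cdot>\<^sub>v u"
  shows "u = 0\<^sub>v d"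
proof (rule ccontr)
  assume nz: "u \<noteq> 0\<^sub>v d"
  have "a * (v \<bullet>c u) + u \<bullet>c u = (A *\<^sub>v v) \<bullet>c u"
    unfolding ch using u v by (simp add: add_scalar_prod_distrib[of _ d])
  also have "\<dots> = v \<bullet>c (a \<cdot>\<^sub>v u)" unfolding hermitian_cscalar_prod[OF A v u] ev ..
  also have "\<dots> = a * (v \<bullet>c u)"
    using cscalar_prod_smult(2)[OF v u, of a] hermitian_eigenvalue_real[OF A u nz ev] by simp
  finally have "u \<bullet>c u = 0" by simp
  then show False using nz u by simp
qed

text \<open>Earlier vectors that belong to another eigenvalue are already orthogonal to
  \<open>w\<close> and get coefficient 0, so the Gram-Schmidt correction stays in the eigenspace of
  \<open>w\<close>.\<close>

lemma adjuster_eigenvector: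
  fixes A :: "complex mat"
  assumes A: "A \<in> carrier_mat d d" "mat_adjoint A = A"
    and w: "w \<in> carrier_vec d" "A *\<^sub>v w = e \<cdot>\<^sub>v w"
    and us: "\<And>u. u \<in> set us \<Longrightarrow> u \<in> carrier_vec d \<and> (\<exists>b. A *\<^sub>v u = b \<cdot>\<^sub>v u)"
  shows "adjuster d w us \<in> carrier_vec d \<and> A *\<^sub>v adjuster d w us = e \<cdot>\<^sub>v adjuster d w us"
  using us
proof (induct us)
  case Nil
  have "A *\<^sub>v 0\<^sub>v d = e \<cdot>\<^sub>v 0\<^sub>v d" using A(1) by (intro eq_vecI) auto
  then show ?case by simp
next
  case (Cons u us)
  then have IH: "adjuster d w us \<in> carrier_vec d" "A *\<^sub>v adjuster d w us = e \<cdot>\<^sub>v adjuster d w us" by auto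
  obtain b where u: "u \<in> carrier_vec d" and b: "A *\<^sub>v u = b \<cdot>\<^sub>v u" using Cons(2)[of u] by auto
  define k where "k = - (w \<bullet>c u) / (u \<bullet>c u)"
  have ku: "k \<cdot>\<^sub>v u \<in> carrier_vec d" using u by simp
  have "A *\<^sub>v (k \<cdot>\<^sub>v u) = e \<cdot>\<^sub>v (k \<cdot>\<^sub>v u)"
  proof (cases "b = e")
    case True
    then show ?thesis using mult_mat_vec[OF A(1) u] b
      by (simp add: smult_smult_assoc mult.commute)
  next
    case False
    then have "k = 0"
      using hermitian_eigenvectors_orthogonal[OF A w(1) u w(2) b] unfolding k_def by simp
    then show ?thesis using mult_mat_vec[OF A(1) u, of 0] u b by (simp add: smult_smult_assoc)
  qed
  then have "A *\<^sub>v (k \<cdot>\<^sub>v u + adjuster d w us) = e \<cdot>\<^sub>v (k \<cdot>\<^sub>v u + adjuster d w us)"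
    unfolding mult_add_distrib_mat_vec[OF A(1) ku IH(1)] IH(2)
    using smult_add_distrib_vec[OF ku IH(1)] by simp
  then show ?case using ku IH(1) unfolding k_def by simp
qed

lemma gram_schmidt_sub_eigenvectors:
  fixes A :: "complex mat"
  assumes A: "A \<in> carrier_mat d d" "mat_adjoint A = A"
    and "\<And>u. u \<in> set us \<union> set ws \<Longrightarrow> u \<in> carrier_vec d \<and> (\<exists>b. A *\<^sub>v u = b \<cdot>\<^sub>v u)"
  shows "u \<in> set (gram_schmidt_sub d us ws) \<Longrightarrow> \<exists>b. A *\<^sub>v u = b \<cdot>\<^sub>v u"
  using assms(3)
proof (induct ws arbitrary: us)
  case (Cons w ws)
  obtain e where w: "w \<in> carrier_vec d" "A *\<^sub>v w = e \<cdot>\<^sub>v w" using Cons(3)[of w] by auto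
  have adj: "adjuster d w us \<in> carrier_vec d" "A *\<^sub>v adjuster d w us = e \<cdot>\<^sub>v adjuster d w us"
    using adjuster_eigenvector[OF A w, of us] Cons(3) by auto
  have "A *\<^sub>v (adjuster d w us + w) = e \<cdot>\<^sub>v (adjuster d w us + w)"
    unfolding mult_add_distrib_mat_vec[OF A(1) adj(1) w(1)] adj(2) w(2)
    using smult_add_distrib_vec[OF adj(1) w(1)] by simp
  then have "\<And>u. u \<in> set ((adjuster d w us + w) # us) \<union> set ws \<Longrightarrow>
      u \<in> carrier_vec d \<and> (\<exists>b. A *\<^sub>v u = b \<cdot>\<^sub>v u)"
    using Cons(3) adj(1) w(1) by auto
  then show ?case using Cons(1)[of "(adjuster d w us + w) # us"] Cons(2) by simp
qed auto

text \<open>The Jordan basis consists of eigenvectors, Gram-Schmidt makes them orthogonal without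
  leaving the eigenspaces, and dividing by the norms makes the matrix of columns unitary.\<close>

lemma hermitian_unitary_diagonalization:
  fixes A :: "complex mat"
  assumes A: "A \<in> carrier_mat d d" "mat_adjoint A = A"
  obtains U lam where "U \<in> carrier_mat d d" "mat_adjoint U * U = 1\<^sub>m d" "U * mat_adjoint U = 1\<^sub>m d"
    "\<And>i. i < d \<Longrightarrow> A *\<^sub>v col U i = complex_of_real (lam i) \<cdot>\<^sub>v col U i"
proof -
  obtain S R a where S: "S \<in> carrier_mat d d" and R: "R \<in> carrier_mat d d"
    and SR: "S * R = 1\<^sub>m d" and RS: "R * S = 1\<^sub>m d"
    and chain: "\<And>j. j < d \<Longrightarrow> A *\<^sub>v col S j = a j \<cdot>\<^sub>v col S j \<or>
      (\<exists>i. j = Suc i \<and> a i = a j \<and> A *\<^sub>v col S j = a j \<cdot>\<^sub>v col S j + col S i)"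
    by (rule jordan_chains[OF A(1)]) blast
  have cS: "col S k \<in> carrier_vec d" for k using S by auto
  have ev: "A *\<^sub>v col S j = a j \<cdot>\<^sub>v col S j" if "j < d" for j
    using that
  proof (induct j rule: less_induct)
    case (less j)
    show ?case
    proof (rule ccontr)
      assume "\<not> ?case"
      then obtain i where i: "j = Suc i" "a i = a j"
        and ch: "A *\<^sub>v col S j = a j \<cdot>\<^sub>v col S j + col S i" using chain[OF less(2)] by auto
      have "i < d" "A *\<^sub>v col S i = a j \<cdot>\<^sub>v col S i" using less(1)[of i] less(2) i by auto
      then show False
        using hermitian_jordan_chain[OF A cS cS ch] invertible_col_nonzero[OF S R RS] by blast
    qed
  qed
  have colsS: "set (cols S) = col S ` {..<d}" using S by (auto simp: cols_def)
  have ker: "c = 0\<^sub>v d" if "c \<in> carrier_vec d" "S *\<^sub>v c = 0\<^sub>v d" for c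
  proof -
    have "c = R *\<^sub>v (S *\<^sub>v c)" using that(1) assoc_mult_mat_vec[OF R S that(1)] RS by simp
    also have "\<dots> = 0\<^sub>v d" unfolding that(2) using R by (intro eq_vecI) auto
    finally show ?thesis .
  qed
  have inj: "inj_on (col S) {..<d}" and li: "\<not> vec_lin_dep d (set (cols S))"
    unfolding colsS using cols_lin_indpt[OF S order_refl ker] by auto
  have dist: "distinct (cols S)"
    using inj S unfolding cols_def by (simp add: distinct_map atLeast0LessThan)
  define us where "us = gram_schmidt d (cols S)"
  have sub: "set (cols S) \<subseteq> carrier_vec d" using S cols_dim by blast
  note gs = cof_vec_space.gram_schmidt_result[OF sub dist li us_def]
  have len: "length us = d" using gs(4) S by simp
  have "\<exists>b. A *\<^sub>v u = b \<cdot>\<^sub>v u" if "u \<in> set us" for u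
  proof (rule gram_schmidt_sub_eigenvectors[OF A])
    show "u \<in> set (gram_schmidt_sub d [] (cols S))" using that unfolding us_def gram_schmidt_def by simp
  qed (use ev cS colsS in auto)
  then have "\<forall>j<d. \<exists>b. A *\<^sub>v us ! j = b \<cdot>\<^sub>v us ! j" using len by auto
  then obtain b where b: "\<And>j. j < d \<Longrightarrow> A *\<^sub>v us ! j = b j \<cdot>\<^sub>v us ! j" by metis
  have us: "us ! j \<in> carrier_vec d" if "j < d" for j using that gs(3) len by auto
  \<comment> \<open>The equivalence includes that self products are nonzero, which allows the
    normalization in \<open>U\<close>.\<close>
  have orth: "us ! i \<bullet>c us ! j = 0 \<longleftrightarrow> i \<noteq> j" if "i < d" "j < d" for i j
    using corthogonalD[OF gs(2)] that len by auto
  have nz: "us ! j \<noteq> 0\<^sub>v d" if "j < d" for j using orth[OF that that] us[OF that] by auto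
  then have vn: "vnorm (us ! j) \<noteq> 0" if "j < d" for j using vnorm_eq_0_iff[OF us] that by simp
  define U where "U = mat d d (\<lambda>(i, j). us ! j $ i / complex_of_real (vnorm (us ! j)))"
  have U: "U \<in> carrier_mat d d" unfolding U_def by simp
  have colU: "col U j = (1 / complex_of_real (vnorm (us ! j))) \<cdot>\<^sub>v us ! j" if "j < d" for j
    using that us[OF that] by (intro eq_vecI) (auto simp: U_def)
  have UU: "mat_adjoint U * U = 1\<^sub>m d"
  proof (rule eq_matI)
    fix i j assume "i < dim_row (1\<^sub>m d :: complex mat)" "j < dim_col (1\<^sub>m d :: complex mat)"
    then have ij: "i < d" "j < d" by auto
    have "(mat_adjoint U * U) $$ (i, j) =
        1 / complex_of_real (vnorm (us ! j)) * (1 / complex_of_real (vnorm (us ! i))) * (us ! j \<bullet>c us ! i)"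
      unfolding adjoint_mult_index[OF U U ij] using ij us
      by (simp add: colU cscalar_prod_smult[of _ d])
    then show "(mat_adjoint U * U) $$ (i, j) = 1\<^sub>m d $$ (i, j)"
      using ij orth[of j i] vn cscalar_prod_self[OF us[OF ij(1)]]
      by (cases "i = j") (auto simp: power2_eq_square)
  qed (use U in auto)
  have UU': "U * mat_adjoint U = 1\<^sub>m d"
    by (rule mat_mult_left_right_inverse[OF mat_adjoint_carrier[OF U] U UU])
  have "A *\<^sub>v col U j = complex_of_real (Re (b j)) \<cdot>\<^sub>v col U j" if j: "j < d" for j
  proof -
    have "complex_of_real (Re (b j)) = b j"
      using hermitian_eigenvalue_real[OF A us[OF j] nz[OF j] b[OF j]] by (simp add: complex_eq_iff)
    then show ?thesis
      using mult_mat_vec[OF A(1) us[OF j]] b[OF j] by (simp add: colU[OF j] smult_smult_assoc mult.commute)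
  qed
  from that[OF U UU UU' this] show thesis .
qed


subsection \<open>Gram matrices of idempotents\<close>

lemma gram_adjoint:
  fixes P :: "complex mat"
  assumes "P \<in> carrier_mat n m"
  shows "mat_adjoint (mat_adjoint P * P) = mat_adjoint P * P"
  using mat_adjoint_mult[OF mat_adjoint_carrier[OF assms] assms] by simp

lemma gram_cscalar_prod:
  fixes P :: "complex mat"
  assumes P: "P \<in> carrier_mat n m" and v: "v \<in> carrier_vec m" and w: "w \<in> carrier_vec m"
  shows "((mat_adjoint P * P) *\<^sub>v v) \<bullet>c w = (P *\<^sub>v v) \<bullet>c (P *\<^sub>v w)"
  using cscalar_prod_adjoint[OF mat_adjoint_carrier[OF P] mult_mat_vec_carrier[OF P v] w]
    assoc_mult_mat_vec[OF mat_adjoint_carrier[OF P] P v] by simp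

lemma gram_psd:
  assumes P: "P \<in> carrier_mat d d"
  shows "psd d (mat_adjoint P * P)"
  unfolding psd_def using gram_carrier[OF P] gram_adjoint[OF P]
  by (auto simp: gram_cscalar_prod[OF P])

lemma idempotent_gram_spectrum:
  assumes P: "P \<in> carrier_mat d d" and PP: "P * P = P"
  shows "spectrum (mat_adjoint P * P) \<subseteq> {0} \<union> {complex_of_real r | r. r \<ge> 1}"
proof
  let ?A = "mat_adjoint P * P"
  note A = gram_carrier[OF P] and P' = mat_adjoint_carrier[OF P]
  fix a assume "a \<in> spectrum ?A"
  then obtain v where v: "v \<in> carrier_vec d" "v \<noteq> 0\<^sub>v d" and ev: "?A *\<^sub>v v = a \<cdot>\<^sub>v v"
    using A unfolding spectrum_def eigenvalue_def eigenvector_def by auto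
  have Pv: "P *\<^sub>v v \<in> carrier_vec d" using mult_mat_vec_carrier[OF P v(1)] .
  have n: "vnorm v > 0" using vnorm_eq_0_iff[OF v(1)] v(2) vnorm_nonneg[of v] by linarith
  have "complex_of_real ((vnorm (P *\<^sub>v v))\<^sup>2) = a * complex_of_real ((vnorm v)\<^sup>2)"
    using gram_cscalar_prod[OF P v(1) v(1)] cscalar_prod_smult(1)[OF v(1) v(1), of a]
    unfolding ev cscalar_prod_self[OF v(1)] cscalar_prod_self[OF Pv] by simp
  \<comment> \<open>The eigenvalue is the Rayleigh quotient of \<open>v\<close>, hence real and
    nonnegative; it remains to bound it below by 1 when it is nonzero.\<close>
  then have a: "a = complex_of_real ((vnorm (P *\<^sub>v v))\<^sup>2 / (vnorm v)\<^sup>2)"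
    using n by (simp add: field_simps)
  show "a \<in> {0} \<union> {complex_of_real r | r. r \<ge> 1}"
  proof (cases "a = 0")
    case False
    text \<open>A nonzero eigenvalue forces \<open>v\<close> into the range of the idempotent \<open>P\<^sup>*\<close>, hence
      \<open>\<parallel>v\<parallel>\<^sup>2 = \<langle>Pv, v\<rangle> \<le> \<parallel>Pv\<parallel> \<parallel>v\<parallel>\<close>.\<close>
    have "mat_adjoint P * ?A = ?A"
      using mat_adjoint_mult[OF P P] assoc_mult_mat[OF P' P' P] unfolding PP by simp
    then have "mat_adjoint P *\<^sub>v (?A *\<^sub>v v) = ?A *\<^sub>v v"
      using assoc_mult_mat_vec[OF P' A v(1)] by simp
    then have "a \<cdot>\<^sub>v (mat_adjoint P *\<^sub>v v) = a \<cdot>\<^sub>v v"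
      unfolding ev using mult_mat_vec[OF P' v(1)] by simp
    then have "inverse a \<cdot>\<^sub>v (a \<cdot>\<^sub>v (mat_adjoint P *\<^sub>v v)) = inverse a \<cdot>\<^sub>v (a \<cdot>\<^sub>v v)" by simp
    then have "mat_adjoint P *\<^sub>v v = v" using False by (simp add: smult_smult_assoc)
    then have "complex_of_real ((vnorm v)\<^sup>2) = (P *\<^sub>v v) \<bullet>c v"
      using cscalar_prod_adjoint[OF P v(1) v(1)] cscalar_prod_self[OF v(1)] by simp
    then have "(vnorm v)\<^sup>2 \<le> vnorm (P *\<^sub>v v) * vnorm v"
      using cmod_cscalar_prod_le[OF Pv v(1)] by (metis norm_of_real abs_of_nonneg zero_le_power2)
    then have "vnorm v \<le> vnorm (P *\<^sub>v v)" using n by (simp add: power2_eq_square)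
    then have "(vnorm (P *\<^sub>v v))\<^sup>2 / (vnorm v)\<^sup>2 \<ge> 1" using n by (simp add: power_mono)
    then show ?thesis using a by blast
  qed simp
qed

subsection \<open>Spectral measure, rank and nullity in an eigenbasis\<close>

lemma minus_eq_0_vecD:
  fixes v w :: "complex vec"
  assumes v: "v \<in> carrier_vec n" and w: "w \<in> carrier_vec n" and "v - w = 0\<^sub>v n"
  shows "v = w"
proof (rule eq_vecI)
  fix i assume i: "i < dim_vec w"
  have "(v - w) $ i = 0\<^sub>v n $ i" using assms(3) by simp
  then show "v $ i = w $ i" using i v w by simp
qed (use v w in simp)

definition unitary_eigenbasis :: "nat \<Rightarrow> complex mat \<Rightarrow> complex mat \<Rightarrow> (nat \<Rightarrow> real) \<Rightarrow> bool" where
  "unitary_eigenbasis d A U lam \<longleftrightarrow> A \<in> carrier_mat d d \<and> mat_adjoint A = A \<and>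
    U \<in> carrier_mat d d \<and> mat_adjoint U * U = 1\<^sub>m d \<and> U * mat_adjoint U = 1\<^sub>m d \<and>
    (\<forall>i<d. A *\<^sub>v col U i = complex_of_real (lam i) \<cdot>\<^sub>v col U i)"

context
  fixes d :: nat and A U :: "complex mat" and lam :: "nat \<Rightarrow> real"
  assumes eigenbasis: "unitary_eigenbasis d A U lam"
begin

lemma carrier_A: "A \<in> carrier_mat d d" and herm_A: "mat_adjoint A = A"
  and carrier_U: "U \<in> carrier_mat d d" and adj_U_U: "mat_adjoint U * U = 1\<^sub>m d"
  and U_adj_U: "U * mat_adjoint U = 1\<^sub>m d"
  using eigenbasis unfolding unitary_eigenbasis_def by blast+

lemma eigen: "i < d \<Longrightarrow> A *\<^sub>v col U i = complex_of_real (lam i) \<cdot>\<^sub>v col U i"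
  using eigenbasis unfolding unitary_eigenbasis_def by blast

definition supported :: "nat set \<Rightarrow> complex vec set" where
  "supported I = {c \<in> carrier_vec d. \<forall>i<d. i \<notin> I \<longrightarrow> c $ i = 0}"

lemma supportedD: "c \<in> supported I \<Longrightarrow> c \<in> carrier_vec d"
  "c \<in> supported I \<Longrightarrow> i < d \<Longrightarrow> i \<notin> I \<Longrightarrow> c $ i = 0"
  unfolding supported_def by auto

lemma adj_U: "mat_adjoint U \<in> carrier_mat d d"
  using carrier_U by simp

lemma col_U: "col U i \<in> carrier_vec d"
  using carrier_U by auto

lemma coords_carrier: "v \<in> carrier_vec d \<Longrightarrow> mat_adjoint U *\<^sub>v v \<in> carrier_vec d"
  using mult_mat_vec_carrier[OF adj_U] .

lemma mult_U_carrier: "c \<in> carrier_vec d \<Longrightarrow> U *\<^sub>v c \<in> carrier_vec d"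
  using mult_mat_vec_carrier[OF carrier_U] .

lemma U_coords: "v \<in> carrier_vec d \<Longrightarrow> U *\<^sub>v (mat_adjoint U *\<^sub>v v) = v"
  using assoc_mult_mat_vec[OF carrier_U adj_U] U_adj_U by simp

lemma coords_U: "c \<in> carrier_vec d \<Longrightarrow> mat_adjoint U *\<^sub>v (U *\<^sub>v c) = c"
  using assoc_mult_mat_vec[OF adj_U carrier_U] adj_U_U by simp

lemma coords_index:
  assumes v: "v \<in> carrier_vec d" and i: "i < d"
  shows "(mat_adjoint U *\<^sub>v v) $ i = v \<bullet>c col U i"
  unfolding mult_mat_vec_index_sum[OF adj_U v i] cscalar_prod_eq_sum[OF col_U]
  using carrier_U i by (intro sum.cong) auto

text \<open>\<open>A\<close> moves to the eigenvector by self-adjointness, and \<open>lam i\<close>,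
  being real, survives the conjugation.\<close>

lemma coords_A_index:
  assumes v: "v \<in> carrier_vec d" and i: "i < d"
  shows "(mat_adjoint U *\<^sub>v (A *\<^sub>v v)) $ i = complex_of_real (lam i) * (mat_adjoint U *\<^sub>v v) $ i"
proof -
  have "(A *\<^sub>v v) \<bullet>c col U i = v \<bullet>c (complex_of_real (lam i) \<cdot>\<^sub>v col U i)"
    unfolding hermitian_cscalar_prod[OF carrier_A herm_A v col_U] eigen[OF i] ..
  then show ?thesis
    using cscalar_prod_smult(2)[OF v col_U]
    by (simp only: coords_index[OF v i] coords_index[OF mult_mat_vec_carrier[OF carrier_A v] i] complex_cnj_complex_of_real)
qed

lemma cscalar_prod_coords:
  assumes "v \<in> carrier_vec d" "w \<in> carrier_vec d"
  shows "v \<bullet>c w = (mat_adjoint U *\<^sub>v v) \<bullet>c (mat_adjoint U *\<^sub>v w)"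
  using cscalar_prod_adjoint[OF adj_U assms(1) coords_carrier[OF assms(2)]] U_coords[OF assms(2)] by simp

lemma cols_U_lin_indpt:
  assumes "I \<subseteq> {..<d}"
  shows "inj_on (col U) I" "\<not> vec_lin_dep d (col U ` I)"
proof -
  have "c = 0\<^sub>v d" if "c \<in> carrier_vec d" "U *\<^sub>v c = 0\<^sub>v d" for c
  proof -
    have "c = mat_adjoint U *\<^sub>v 0\<^sub>v d" using coords_U[OF that(1)] that(2) by simp
    also have "\<dots> = 0\<^sub>v d" using carrier_U by (intro eq_vecI) auto
    finally show ?thesis .
  qed
  then show "inj_on (col U) I" "\<not> vec_lin_dep d (col U ` I)"
    using cols_lin_indpt[OF carrier_U assms] by auto
qed

lemma span_cols_U:
  assumes "I \<subseteq> {..<d}"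
  shows "vec_span d (col U ` I) = (\<lambda>c. U *\<^sub>v c) ` supported I"
  unfolding span_cols[OF carrier_U assms cols_U_lin_indpt(1)[OF assms]] supported_def by auto

text \<open>Since \<open>U\<close> is unitary, the coordinates of \<open>v\<close> are
  \<open>mat_adjoint U *\<^sub>v v\<close>. The spectral subspace, the range of the projection and
  the kernel are all described through this vanishing test.\<close>

lemma in_image_supported_iff:
  assumes "v \<in> carrier_vec d"
  shows "v \<in> (\<lambda>c. U *\<^sub>v c) ` supported I \<longleftrightarrow> (\<forall>i<d. i \<notin> I \<longrightarrow> (mat_adjoint U *\<^sub>v v) $ i = 0)"
proof
  assume "v \<in> (\<lambda>c. U *\<^sub>v c) ` supported I"
  then obtain c where c: "v = U *\<^sub>v c" "c \<in> supported I" by auto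
  then show "\<forall>i<d. i \<notin> I \<longrightarrow> (mat_adjoint U *\<^sub>v v) $ i = 0"
    using coords_U[OF supportedD(1)[OF c(2)]] supportedD(2)[OF c(2)] by simp
next
  assume "\<forall>i<d. i \<notin> I \<longrightarrow> (mat_adjoint U *\<^sub>v v) $ i = 0"
  then have "mat_adjoint U *\<^sub>v v \<in> supported I"
    using coords_carrier[OF assms] unfolding supported_def by simp
  then show "v \<in> (\<lambda>c. U *\<^sub>v c) ` supported I" using U_coords[OF assms] by (metis imageI)
qed

lemma dim_span_cols_U:
  assumes "I \<subseteq> {..<d}"
  shows "vectorspace.dim class_ring
    ((module_vec TYPE(complex) d)\<lparr>carrier := vec_span d (col U ` I)\<rparr>) = card I"
  using dim_span_indpt[OF _ _ cols_U_lin_indpt(2)[OF assms]] col_U finite_subset[OF assms]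
    card_image[OF cols_U_lin_indpt(1)[OF assms]] by auto

lemma eigenvector_col_U:
  assumes "i < d"
  shows "eigenvector A (col U i) (complex_of_real (lam i))"
  using invertible_col_nonzero[OF carrier_U adj_U adj_U_U assms] carrier_A col_U eigen[OF assms]
  unfolding eigenvector_def by simp

text \<open>An eigenvector for \<open>c\<close> has zero coordinate wherever \<open>lam i\<close>
  differs from \<open>c\<close>, so it lies in the span of the selected columns; these columns are
  themselves eigenvectors of the required kind.\<close>

lemma spectral_subspace_eq:
  "spectral_subspace d A S = (\<lambda>c. U *\<^sub>v c) ` supported {i. i < d \<and> complex_of_real (lam i) \<in> S}"
proof -
  let ?I = "{i. i < d \<and> complex_of_real (lam i) \<in> S}"
  let ?X = "{v. \<exists>c\<in>S. eigenvector A v c}"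
  have I: "?I \<subseteq> {..<d}" by auto
  have "?X \<subseteq> vec_span d (col U ` ?I)"
  proof
    fix v assume "v \<in> ?X"
    then obtain c where c: "c \<in> S" "eigenvector A v c" by auto
    then have v: "v \<in> carrier_vec d" and ev: "A *\<^sub>v v = c \<cdot>\<^sub>v v"
      using carrier_A unfolding eigenvector_def by auto
    have "(mat_adjoint U *\<^sub>v v) $ i = 0" if i: "i < d" "i \<notin> ?I" for i
    proof -
      have "complex_of_real (lam i) * (mat_adjoint U *\<^sub>v v) $ i = c * (mat_adjoint U *\<^sub>v v) $ i"
        using coords_A_index[OF v i(1)] carrier_vecD[OF coords_carrier[OF v]] i(1)
        unfolding ev mult_mat_vec[OF adj_U v] by (auto simp del: index_mult_mat_vec dim_mult_mat_vec)
      moreover have "complex_of_real (lam i) \<noteq> c" using i c by auto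
      ultimately show ?thesis by simp
    qed
    then show "v \<in> vec_span d (col U ` ?I)"
      unfolding span_cols_U[OF I] in_image_supported_iff[OF v] by blast
  qed
  moreover have "col U ` ?I \<subseteq> ?X" using eigenvector_col_U by auto
  moreover have "col U ` ?I \<subseteq> carrier_vec d" using col_U by auto
  ultimately show ?thesis
    unfolding spectral_subspace_def span_cols_U[OF I, symmetric] by (rule vec_span_eqI)
qed

definition spectral_proj :: "nat set \<Rightarrow> complex mat" where
  "spectral_proj I = U * mat_diag d (\<lambda>i. if i \<in> I then 1 else 0) * mat_adjoint U"

lemma spectral_proj_carrier: "spectral_proj I \<in> carrier_mat d d"
  unfolding spectral_proj_def using carrier_U by (simp add: mult_carrier_mat[of _ d d])

lemma coords_spectral_proj_index:
  assumes v: "v \<in> carrier_vec d" and i: "i < d"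
  shows "(mat_adjoint U *\<^sub>v (spectral_proj I *\<^sub>v v)) $ i =
    (if i \<in> I then (mat_adjoint U *\<^sub>v v) $ i else 0)"
proof -
  let ?D = "mat_diag d (\<lambda>i. if i \<in> I then 1 else 0 :: complex)"
  let ?y = "mat_adjoint U *\<^sub>v v"
  have D: "?D \<in> carrier_mat d d" by simp
  have y: "?y \<in> carrier_vec d" using coords_carrier[OF v] .
  have Dy: "?D *\<^sub>v ?y \<in> carrier_vec d" using mult_mat_vec_carrier[OF D y] .
  have "spectral_proj I *\<^sub>v v = U *\<^sub>v (?D *\<^sub>v ?y)"
    unfolding spectral_proj_def assoc_mult_mat_vec[OF mult_carrier_mat[OF carrier_U D] adj_U v]
      assoc_mult_mat_vec[OF carrier_U D y] ..
  then have "(mat_adjoint U *\<^sub>v (spectral_proj I *\<^sub>v v)) $ i = (?D *\<^sub>v ?y) $ i"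
    using coords_U[OF Dy] by simp
  also have "\<dots> = (\<Sum>j<d. if j = i then (if i \<in> I then ?y $ i else 0) else 0)"
    unfolding mult_mat_vec_index_sum[OF D y i]
    by (intro sum.cong) (use i in \<open>auto simp: mat_diag_def simp del: index_mult_mat_vec\<close>)
  also have "\<dots> = (if i \<in> I then ?y $ i else 0)" using i by (simp del: index_mult_mat_vec)
  finally show ?thesis .
qed

text \<open>The measure is a definite description, so the explicit projection must be shown to
  satisfy its two conditions and to be the only matrix that does.\<close>

lemma spectral_measure_eq:
  "spectral_measure d A S = spectral_proj {i. i < d \<and> complex_of_real (lam i) \<in> S}"
proof -
  let ?I = "{i. i < d \<and> complex_of_real (lam i) \<in> S}"
  let ?E = "spectral_proj ?I"
  let ?L = "(\<lambda>c. U *\<^sub>v c) ` supported ?I"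
  let ?Q = "\<lambda>P. P \<in> carrier_mat d d \<and> (\<forall>v \<in> carrier_vec d. P *\<^sub>v v \<in> ?L) \<and>
     (\<forall>v \<in> carrier_vec d. \<forall>w \<in> ?L. (v - P *\<^sub>v v) \<bullet>c w = 0)"
  have E: "?E \<in> carrier_mat d d" by (rule spectral_proj_carrier)
  have sub: "mat_adjoint U *\<^sub>v (v - w) = mat_adjoint U *\<^sub>v v - mat_adjoint U *\<^sub>v w"
    if "v \<in> carrier_vec d" "w \<in> carrier_vec d" for v w
    using mult_minus_distrib_mat_vec[OF adj_U that] .
  have sub_index: "(mat_adjoint U *\<^sub>v (v - w)) $ i = (mat_adjoint U *\<^sub>v v) $ i - (mat_adjoint U *\<^sub>v w) $ i"
    if "v \<in> carrier_vec d" "w \<in> carrier_vec d" "i < d" for v w i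
    unfolding sub[OF that(1,2)] using that(3) coords_carrier[OF that(1)] coords_carrier[OF that(2)]
    by (simp del: index_mult_mat_vec dim_mult_mat_vec add: carrier_vecD)
  have L: "w \<in> carrier_vec d" if "w \<in> ?L" for w using that mult_U_carrier supportedD(1) by auto
  have Ev: "?E *\<^sub>v v \<in> carrier_vec d" if "v \<in> carrier_vec d" for v
    using mult_mat_vec_carrier[OF E that] .
  have QE: "?Q ?E"
  proof (intro conjI ballI E)
    fix v :: "complex vec" assume v: "v \<in> carrier_vec d"
    show "?E *\<^sub>v v \<in> ?L"
      unfolding in_image_supported_iff[OF Ev[OF v]]
      by (simp add: coords_spectral_proj_index[OF v] del: index_mult_mat_vec)
    fix w assume w: "w \<in> ?L"
    have "(v - ?E *\<^sub>v v) \<bullet>c w =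
        (\<Sum>i<d. (mat_adjoint U *\<^sub>v (v - ?E *\<^sub>v v)) $ i * cnj ((mat_adjoint U *\<^sub>v w) $ i))"
      using cscalar_prod_coords[of "v - ?E *\<^sub>v v" w] L[OF w] v Ev[OF v]
        cscalar_prod_eq_sum[OF coords_carrier[OF L[OF w]]] by simp
    also have "\<dots> = 0"
    proof (intro sum.neutral ballI)
      fix i assume "i \<in> {..<d}"
      then have i: "i < d" by simp
      have "(mat_adjoint U *\<^sub>v w) $ i = 0" if "i \<notin> ?I"
        using w that i unfolding in_image_supported_iff[OF L[OF w]] by blast
      then show "(mat_adjoint U *\<^sub>v (v - ?E *\<^sub>v v)) $ i * cnj ((mat_adjoint U *\<^sub>v w) $ i) = 0"
        unfolding sub_index[OF v Ev[OF v] i] coords_spectral_proj_index[OF v i]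
        by (cases "i \<in> ?I") (simp_all del: index_mult_mat_vec)
    qed
    finally show "(v - ?E *\<^sub>v v) \<bullet>c w = 0" .
  qed
  have unique: "P = ?E" if P: "?Q P" for P
  proof (rule eq_mat_mult_vecI)
    show "P \<in> carrier_mat d d" "?E \<in> carrier_mat d d" using P E by auto
    fix v :: "complex vec" assume v: "v \<in> carrier_vec d"
    have Pv: "P *\<^sub>v v \<in> ?L" using P v by blast
    \<comment> \<open>This vector lies in the subspace and is also a difference of two residuals
      orthogonal to the subspace, so it is orthogonal to itself.\<close>
    define w where "w = ?E *\<^sub>v v - P *\<^sub>v v"
    have w: "w \<in> carrier_vec d" unfolding w_def using Ev[OF v] L[OF Pv] by simp
    have wL: "w \<in> ?L"
      unfolding in_image_supported_iff[OF w] unfolding w_def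
    proof (intro allI impI)
      fix i assume i: "i < d" "i \<notin> ?I"
      have "?E *\<^sub>v v \<in> ?L" using QE v by blast
      then show "(mat_adjoint U *\<^sub>v (?E *\<^sub>v v - P *\<^sub>v v)) $ i = 0"
        using Pv i unfolding in_image_supported_iff[OF L[OF Pv]] in_image_supported_iff[OF Ev[OF v]]
          sub_index[OF Ev[OF v] L[OF Pv] i(1)] by simp
    qed
    have vP: "v - P *\<^sub>v v \<in> carrier_vec d" and vE: "v - ?E *\<^sub>v v \<in> carrier_vec d"
      using v L[OF Pv] Ev[OF v] by auto
    have "w = (v - P *\<^sub>v v) - (v - ?E *\<^sub>v v)"
      unfolding w_def using v L[OF Pv] Ev[OF v] by (intro eq_vecI) (auto simp del: index_mult_mat_vec dim_mult_mat_vec)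
    then have "w \<bullet>c w = (v - P *\<^sub>v v) \<bullet>c w - (v - ?E *\<^sub>v v) \<bullet>c w"
      using minus_scalar_prod_distrib[OF vP vE, of "conjugate w"] w by simp
    also have "(v - P *\<^sub>v v) \<bullet>c w = 0" using P wL v by blast
    also have "(v - ?E *\<^sub>v v) \<bullet>c w = 0" using QE wL v by blast
    finally have "w = 0\<^sub>v d" using w by simp
    then show "P *\<^sub>v v = ?E *\<^sub>v v"
      unfolding w_def using minus_eq_0_vecD[OF Ev[OF v] L[OF Pv]] by simp
  qed
  show ?thesis unfolding spectral_measure_def spectral_subspace_eq
    using QE unique by (rule the_equality)
qed

text \<open>The column space is the span of the selected columns of \<open>U\<close>: images have
  the right vanishing coordinates, and vectors of the span are fixed.\<close>

lemma mat_rank_spectral_proj: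
  assumes I: "I \<subseteq> {..<d}"
  shows "mat_rank d (spectral_proj I) = card I"
proof -
  let ?E = "spectral_proj I"
  have E: "?E \<in> carrier_mat d d" by (rule spectral_proj_carrier)
  have "vec_span d (set (cols ?E)) = (\<lambda>v. ?E *\<^sub>v v) ` carrier_vec d"
    by (rule span_set_cols[OF E])
  also have "\<dots> = (\<lambda>c. U *\<^sub>v c) ` supported I"
  proof (intro equalityI subsetI)
    fix w assume "w \<in> (\<lambda>v. ?E *\<^sub>v v) ` carrier_vec d"
    then obtain v where v: "v \<in> carrier_vec d" "w = ?E *\<^sub>v v" by auto
    then have w: "w \<in> carrier_vec d" using mult_mat_vec_carrier[OF E] by simp
    show "w \<in> (\<lambda>c. U *\<^sub>v c) ` supported I"
      unfolding in_image_supported_iff[OF w] unfolding v(2)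
      by (simp add: coords_spectral_proj_index[OF v(1)] del: index_mult_mat_vec)
  next
    fix w assume wL: "w \<in> (\<lambda>c. U *\<^sub>v c) ` supported I"
    then have w: "w \<in> carrier_vec d" using mult_U_carrier supportedD(1) by auto
    have Ew: "?E *\<^sub>v w \<in> carrier_vec d" using mult_mat_vec_carrier[OF E w] .
    have "mat_adjoint U *\<^sub>v (?E *\<^sub>v w) = mat_adjoint U *\<^sub>v w"
      using wL coords_carrier[OF w] coords_carrier[OF Ew] coords_spectral_proj_index[OF w]
      unfolding in_image_supported_iff[OF w]
      by (intro eq_vecI) (auto simp del: index_mult_mat_vec dim_mult_mat_vec)
    then have "?E *\<^sub>v w = w" using U_coords[OF w] U_coords[OF Ew] by simp
    then show "w \<in> (\<lambda>v. ?E *\<^sub>v v) ` carrier_vec d" using w by (metis imageI)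
  qed
  finally have "vec_span d (set (cols ?E)) = vec_span d (col U ` I)" unfolding span_cols_U[OF I] .
  then show ?thesis unfolding mat_rank_def vec_space.rank_def using dim_span_cols_U[OF I] by simp
qed

lemma mat_kernel_eq: "mat_kernel A = vec_span d (col U ` {i. i < d \<and> lam i = 0})"
proof -
  let ?I = "{i. i < d \<and> lam i = 0}"
  have I: "?I \<subseteq> {..<d}" by auto
  have "mat_kernel A = (\<lambda>c. U *\<^sub>v c) ` supported ?I"
  proof (intro equalityI subsetI)
    fix v assume "v \<in> mat_kernel A"
    then have v: "v \<in> carrier_vec d" and Av: "A *\<^sub>v v = 0\<^sub>v d" using mat_kernelD[OF carrier_A] by auto
    have "mat_adjoint U *\<^sub>v 0\<^sub>v d = 0\<^sub>v d" using carrier_U by (intro eq_vecI) auto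
    then have "(mat_adjoint U *\<^sub>v v) $ i = 0" if "i < d" "i \<notin> ?I" for i
      using coords_A_index[OF v that(1)] that unfolding Av by (simp del: index_mult_mat_vec)
    then show "v \<in> (\<lambda>c. U *\<^sub>v c) ` supported ?I" unfolding in_image_supported_iff[OF v] by blast
  next
    fix v assume vL: "v \<in> (\<lambda>c. U *\<^sub>v c) ` supported ?I"
    then have v: "v \<in> carrier_vec d" using mult_U_carrier supportedD(1) by auto
    have Av: "A *\<^sub>v v \<in> carrier_vec d" using mult_mat_vec_carrier[OF carrier_A v] .
    have "(mat_adjoint U *\<^sub>v (A *\<^sub>v v)) $ i = 0" if "i < d" for i
      using vL that unfolding in_image_supported_iff[OF v] coords_A_index[OF v that]
      by (cases "i \<in> ?I") (auto simp del: index_mult_mat_vec)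
    then have "mat_adjoint U *\<^sub>v (A *\<^sub>v v) = 0\<^sub>v d"
      using coords_carrier[OF Av] by (intro eq_vecI) (auto simp del: index_mult_mat_vec dim_mult_mat_vec)
    then have "A *\<^sub>v v = U *\<^sub>v 0\<^sub>v d" using U_coords[OF Av] by simp
    also have "\<dots> = 0\<^sub>v d" using carrier_U by (intro eq_vecI) auto
    finally show "v \<in> mat_kernel A" by (intro mat_kernelI[OF carrier_A v])
  qed
  then show ?thesis unfolding span_cols_U[OF I] .
qed

lemma kernel_dim_eq: "kernel_dim A = card {i. i < d \<and> lam i = 0}"
  unfolding kernel_dim_def mat_kernel_eq using carrier_A dim_span_cols_U[of "{i. i < d \<and> lam i = 0}"] by auto

lemma mat_rank_spectral_measure_gt_1:
  "mat_rank d (spectral_measure d A {complex_of_real r | r. r > 1}) = card {i. i < d \<and> lam i > 1}"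
proof -
  have "{i. i < d \<and> complex_of_real (lam i) \<in> {complex_of_real r | r. r > 1}} = {i. i < d \<and> lam i > 1}"
    by auto
  then show ?thesis unfolding spectral_measure_eq using mat_rank_spectral_proj[of "{i. i < d \<and> lam i > 1}"]
    by auto
qed

text \<open>The images under \<open>1\<^sub>m d - P\<close> of the eigenvectors for eigenvalues
  above 1 form an independent family inside the kernel, which is spanned by the columns with
  eigenvalue 0.\<close>

lemma idempotent_gram_kernel_dim:
  assumes P: "P \<in> carrier_mat d d" and PP: "P * P = P" and AP: "A = mat_adjoint P * P"
  shows "card {i. i < d \<and> lam i > 1} \<le> kernel_dim A"
proof -
  let ?I = "{i. i < d \<and> lam i > 1}"
  define W where "W = (1\<^sub>m d - P) * U"
  have Q: "1\<^sub>m d - P \<in> carrier_mat d d" using P by (rule minus_carrier_mat)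
  have W: "W \<in> carrier_mat d d" unfolding W_def using Q carrier_U by simp
  have I: "?I \<subseteq> {..<d}" by auto
  have Wv: "W *\<^sub>v c = U *\<^sub>v c - P *\<^sub>v (U *\<^sub>v c)" if "c \<in> carrier_vec d" for c
    unfolding W_def using assoc_mult_mat_vec[OF Q carrier_U that] mult_U_carrier[OF that] P
    by (simp add: minus_mult_distrib_mat_vec[of _ d d])
  have ker: "c = 0\<^sub>v d"
    if c: "c \<in> carrier_vec d" "\<And>i. i < d \<Longrightarrow> i \<notin> ?I \<Longrightarrow> c $ i = 0" and 0: "W *\<^sub>v c = 0\<^sub>v d" for c
  proof -
    define v where "v = U *\<^sub>v c"
    have v: "v \<in> carrier_vec d" unfolding v_def using mult_U_carrier[OF c(1)] .
    have Pv: "P *\<^sub>v v \<in> carrier_vec d" using mult_mat_vec_carrier[OF P v] .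
    have "v - P *\<^sub>v v = 0\<^sub>v d" using 0 Wv[OF c(1)] unfolding v_def by simp
    then have "P *\<^sub>v v = v" using minus_eq_0_vecD[OF v Pv] by simp
    then have e1: "(A *\<^sub>v v) \<bullet>c v = v \<bullet>c v" unfolding AP gram_cscalar_prod[OF P v v] by simp
    have e2: "(A *\<^sub>v v) \<bullet>c v = (\<Sum>i<d. complex_of_real (lam i * (cmod (c $ i))\<^sup>2))"
      using cscalar_prod_coords[OF mult_mat_vec_carrier[OF carrier_A v] v] coords_A_index[OF v] coords_U[OF c(1)]
      unfolding v_def[symmetric]
      by (simp add: cscalar_prod_eq_sum[OF c(1)] complex_norm_square[symmetric] mult.assoc del: index_mult_mat_vec)
    have e3: "v \<bullet>c v = (\<Sum>i<d. complex_of_real ((cmod (c $ i))\<^sup>2))"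
      using cscalar_prod_coords[OF v v] coords_U[OF c(1)]
      unfolding v_def[symmetric]
      by (simp add: cscalar_prod_eq_sum[OF c(1)] complex_norm_square[symmetric] del: index_mult_mat_vec)
    \<comment> \<open>Comparing the two expansions leaves a vanishing sum of nonnegative terms
      \<open>(lam i - 1) * (cmod (c $ i))\<^sup>2\<close>; the factor is strictly positive wherever
      \<open>c\<close> may be nonzero.\<close>
    have "(\<Sum>i<d. lam i * (cmod (c $ i))\<^sup>2) = (\<Sum>i<d. (cmod (c $ i))\<^sup>2)"
      using e1[unfolded e2 e3 of_real_sum[symmetric]] by (simp only: of_real_eq_iff)
    then have sum0: "(\<Sum>i<d. (lam i - 1) * (cmod (c $ i))\<^sup>2) = 0"
      by (simp add: left_diff_distrib sum_subtractf)
    have supp: "lam i > 1 \<or> c $ i = 0" if "i < d" for i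
      using c(2)[OF that] that by (cases "lam i > 1") simp_all
    have "(lam i - 1) * (cmod (c $ i))\<^sup>2 \<ge> 0" if "i \<in> {..<d}" for i
      using supp[of i] that by auto
    from sum_nonneg_eq_0_iff[THEN iffD1, OF _ this sum0]
    have "(lam i - 1) * (cmod (c $ i))\<^sup>2 = 0" if "i < d" for i using that by simp
    then have "c $ i = 0" if "i < d" for i using supp[OF that] that by fastforce
    then show ?thesis using c(1) by (intro eq_vecI) auto
  qed
  have li: "inj_on (col W) ?I" "\<not> vec_lin_dep d (col W ` ?I)"
    by (rule cols_lin_indpt[OF W I], rule ker, assumption+)+
  have sub: "col W ` ?I \<subseteq> mat_kernel A"
  proof (intro image_subsetI mat_kernelI[OF carrier_A])
    fix i assume "i \<in> ?I"
    then have i: "i < d" by simp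
    show "col W i \<in> carrier_vec d" using W by auto
    \<comment> \<open>The complementary projection has its range in the kernel of \<open>P\<close>,
      which \<open>A\<close> annihilates as well.\<close>
    have "P * (1\<^sub>m d - P) = 0\<^sub>m d d"
      using P PP mult_minus_distrib_mat[OF P one_carrier_mat P] by simp
    then have PW: "P * W = 0\<^sub>m d d"
      unfolding W_def using assoc_mult_mat[OF P Q carrier_U] carrier_U by simp
    have "A *\<^sub>v col W i = col (A * W) i" using col_mult2[OF carrier_A W i] by simp
    also have "A * W = mat_adjoint P * (P * W)"
      unfolding AP using assoc_mult_mat[OF mat_adjoint_carrier[OF P] P W] .
    also have "col \<dots> i = 0\<^sub>v d" unfolding PW using P i by simp
    finally show "A *\<^sub>v col W i = 0\<^sub>v d" .
  qed
  let ?K = "{i. i < d \<and> lam i = 0}"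
  have I0: "?K \<subseteq> {..<d}" by auto
  have "card (col W ` ?I) \<le> card (col U ` ?K)"
  proof (rule card_indpt_le[OF _ _ cols_U_lin_indpt(2)[OF I0] _ _ _ li(2)])
    show "col W ` ?I \<subseteq> vec_span d (col U ` ?K)" using sub unfolding mat_kernel_eq .
    show "col W ` ?I \<subseteq> carrier_vec d" "col U ` ?K \<subseteq> carrier_vec d" using W carrier_U by auto
  qed (use finite_subset[OF I] finite_subset[OF I0] in simp_all)
  then show ?thesis
    unfolding kernel_dim_eq using card_image[OF li(1)] card_image[OF cols_U_lin_indpt(1)[OF I0]] by simp
qed

lemma A_eq: "A = U * mat_diag d (\<lambda>i. complex_of_real (lam i)) * mat_adjoint U"
proof -
  let ?D = "mat_diag d (\<lambda>i. complex_of_real (lam i))"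
  have AU: "A * U = U * ?D"
  proof (rule eq_matI)
    fix i j assume "i < dim_row (U * ?D)" "j < dim_col (U * ?D)"
    then have ij: "i < d" "j < d" using carrier_U by (auto simp: mat_diag_def)
    have "(A * U) $$ (i, j) = (A *\<^sub>v col U j) $ i" using carrier_A carrier_U ij by simp
    then show "(A * U) $$ (i, j) = (U * ?D) $$ (i, j)"
      unfolding eigen[OF ij(2)] mat_diag_mult_right[OF carrier_U] using carrier_U ij by simp
  qed (use carrier_A carrier_U in \<open>auto simp: mat_diag_def\<close>)
  have "A = A * (U * mat_adjoint U)" using carrier_A U_adj_U by simp
  also have "\<dots> = A * U * mat_adjoint U" using assoc_mult_mat[OF carrier_A carrier_U adj_U] by simp
  finally show ?thesis unfolding AU .
qed

text \<open>Pairing every eigenvalue greater than one with a kernel direction leaves room for the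
  off-diagonal entry \<open>sqrt (lam i - 1)\<close> of an idempotent whose column \<open>i\<close> has squared length
  \<open>lam i\<close>.\<close>

lemma gram_of_idempotent:
  assumes lam: "\<And>i. i < d \<Longrightarrow> lam i = 0 \<or> lam i \<ge> 1"
    and le: "card {i. i < d \<and> lam i > 1} \<le> card {i. i < d \<and> lam i = 0}"
  obtains P where "P \<in> carrier_mat d d" "P * P = P" "A = mat_adjoint P * P"
proof -
  let ?I0 = "{i. i < d \<and> lam i = 0}" and ?I1 = "{i. i < d \<and> lam i > 1}"
  obtain f where f: "f ` ?I1 \<subseteq> ?I0" "inj_on f ?I1" using card_le_inj[OF _ _ le] by auto
  \<comment> \<open>\<open>h\<close> extends the pairing to all indices. Off \<open>?I1\<close> the
    weight \<open>\<beta>\<close> below is 0, and the default value \<open>i\<close> keeps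
    \<open>h i\<close> below \<open>d\<close>.\<close>
  define h where "h i = (if i \<in> ?I1 then f i else i)" for i
  define \<alpha> :: "nat \<Rightarrow> real" where "\<alpha> i = (if lam i = 0 then 0 else 1)" for i
  define \<beta> :: "nat \<Rightarrow> real" where "\<beta> i = (if lam i > 1 then sqrt (lam i - 1) else 0)" for i
  \<comment> \<open>Column \<open>i\<close> is \<open>\<alpha> i\<close> times the unit vector at
    \<open>i\<close> plus \<open>\<beta> i\<close> times the one at \<open>h i\<close>: zero for
    eigenvalue 0, the unit vector for eigenvalue 1, and tilted towards the paired kernel direction
    above 1.\<close>
  define q where "q k i = (if k = i then \<alpha> i else 0) + (if k = h i then \<beta> i else 0)" for k i
  have h: "h i < d" if "i < d" for i using f that unfolding h_def by auto
  have hI: "h i \<in> ?I0" if "i < d" "\<beta> i \<noteq> 0" for i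
    using f(1) that unfolding h_def \<beta>_def by (auto split: if_splits)
  \<comment> \<open>The column at a paired kernel index is zero; this removes the second-order terms
    when \<open>q\<close> is squared.\<close>
  have h0: "\<alpha> (h i) = 0" "\<beta> (h i) = 0" if "i < d" "\<beta> i \<noteq> 0" for i
    using hI[OF that] unfolding \<alpha>_def \<beta>_def by auto
  have h_inj: "h i = h j \<longleftrightarrow> i = j" if "i < d" "j < d" "\<beta> i \<noteq> 0" "\<beta> j \<noteq> 0" for i j
    using inj_onD[OF f(2), of i j] that unfolding h_def \<beta>_def by (auto split: if_splits)
  have col_sum: "(\<Sum>k<d. g k * q k j) = \<alpha> j * g j + \<beta> j * g (h j)" if j: "j < d" for g j
  proof -
    have "(\<Sum>k<d. g k * q k j) = (\<Sum>k<d. (if k = j then g j * \<alpha> j else 0) + (if k = h j then g (h j) * \<beta> j else 0))"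
      unfolding q_def by (intro sum.cong) (auto simp: algebra_simps)
    then show ?thesis using j h[OF j] by (simp add: sum.distrib mult.commute)
  qed
  have qq: "(\<Sum>k<d. q i k * q k j) = q i j" if "i < d" "j < d" for i j
    unfolding col_sum[OF that(2)] using h0[OF that(2)]
    by (cases "\<beta> j = 0") (auto simp: q_def \<alpha>_def \<beta>_def)
  \<comment> \<open>The mixed terms vanish because \<open>\<alpha>\<close> is 0 at paired indices,
    and injectivity of the pairing keeps different columns orthogonal. On the diagonal,
    \<open>1 + (lam j - 1)\<close> remains in the case above 1.\<close>
  have gram: "(\<Sum>k<d. q k i * q k j) = (if i = j then lam j else 0)" if ij: "i < d" "j < d" for i j
  proof -
    have diag: "\<alpha> j * \<alpha> j + \<beta> j * \<beta> j = lam j" using lam[OF ij(2)] by (auto simp: \<alpha>_def \<beta>_def)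
    have 1: "\<alpha> j = 0" if "j = h i" "\<beta> i \<noteq> 0" using h0[OF ij(1) that(2)] that by simp
    have 2: "\<alpha> i = 0" if "h j = i" "\<beta> j \<noteq> 0" using h0[OF ij(2) that(2)] that by simp
    have 3: "h j = h i \<longleftrightarrow> i = j" if "\<beta> i \<noteq> 0" "\<beta> j \<noteq> 0" using h_inj[OF ij that] by auto
    have "(\<Sum>k<d. q k i * q k j) = \<alpha> j * q j i + \<beta> j * q (h j) i" by (rule col_sum[OF ij(2)])
    also have "\<dots> = (if j = i then \<alpha> j * \<alpha> i else 0) + (if j = h i then \<alpha> j * \<beta> i else 0)
        + (if h j = i then \<beta> j * \<alpha> i else 0) + (if h j = h i then \<beta> j * \<beta> i else 0)"
      unfolding q_def by (auto simp: algebra_simps)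
    also have "(if j = h i then \<alpha> j * \<beta> i else 0) = 0" using 1 by auto
    also have "(if h j = i then \<beta> j * \<alpha> i else 0) = 0" using 2 by auto
    also have "(if h j = h i then \<beta> j * \<beta> i else 0) = (if i = j then \<beta> j * \<beta> j else 0)"
      using 3 by auto
    finally show ?thesis using diag by auto
  qed
  define Q where "Q = mat d d (\<lambda>(k, i). complex_of_real (q k i))"
  define P where "P = U * Q * mat_adjoint U"
  let ?D = "mat_diag d (\<lambda>i. complex_of_real (lam i))"
  have Q: "Q \<in> carrier_mat d d" unfolding Q_def by simp
  have Q': "mat_adjoint Q \<in> carrier_mat d d" using Q by simp
  have P: "P \<in> carrier_mat d d" unfolding P_def using carrier_U Q adj_U by (simp add: mult_carrier_mat[of _ d d])
  note assoc = assoc_mult_mat[of _ d d _ d _ d] and cm = mult_carrier_mat[of _ d d _ d]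
  have QQ: "Q * Q = Q"
  proof (rule eq_matI)
    fix i j assume "i < dim_row Q" "j < dim_col Q"
    then have ij: "i < d" "j < d" using Q by auto
    have "(Q * Q) $$ (i, j) = complex_of_real (\<Sum>k<d. q i k * q k j)"
      unfolding mult_mat_index_sum[OF Q Q ij] using ij by (simp add: Q_def)
    then show "(Q * Q) $$ (i, j) = Q $$ (i, j)" unfolding qq[OF ij] using ij by (simp add: Q_def)
  qed (use Q in auto)
  have Q'Q: "mat_adjoint Q * Q = ?D"
  proof (rule eq_matI)
    fix i j assume "i < dim_row ?D" "j < dim_col ?D"
    then have ij: "i < d" "j < d" by (auto simp: mat_diag_def)
    have "(mat_adjoint Q * Q) $$ (i, j) = complex_of_real (\<Sum>k<d. q k i * q k j)"
      unfolding mult_mat_index_sum[OF Q' Q ij] using ij Q by (simp add: Q_def)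
    then show "(mat_adjoint Q * Q) $$ (i, j) = ?D $$ (i, j)"
      unfolding gram[OF ij] using ij by (simp add: mat_diag_def)
  qed (use Q in \<open>auto simp: mat_diag_def\<close>)
  \<comment> \<open>Conjugation by a unitary matrix is multiplicative, which transfers the
    identities for \<open>Q\<close> to \<open>P\<close>.\<close>
  have conj: "(U * X * mat_adjoint U) * (U * Y * mat_adjoint U) = U * (X * Y) * mat_adjoint U"
    if "X \<in> carrier_mat d d" "Y \<in> carrier_mat d d" for X Y
  proof -
    have "(U * X * mat_adjoint U) * (U * Y * mat_adjoint U) =
        U * X * ((mat_adjoint U * U) * (Y * mat_adjoint U))"
      using that carrier_U adj_U by (simp add: assoc cm)
    also have "\<dots> = U * (X * Y) * mat_adjoint U"
      unfolding adj_U_U using that carrier_U adj_U by (simp add: assoc cm)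
    finally show ?thesis .
  qed
  have "P * P = P" unfolding P_def conj[OF Q Q] QQ ..
  moreover have "mat_adjoint P = U * mat_adjoint Q * mat_adjoint U"
    unfolding P_def using mat_adjoint_mult[OF mult_carrier_mat[OF carrier_U Q] adj_U] mat_adjoint_mult[OF carrier_U Q]
      carrier_U adj_U Q' by (simp add: assoc)
  then have "mat_adjoint P * P = U * ?D * mat_adjoint U"
    unfolding P_def using conj[OF Q' Q] Q'Q by simp
  ultimately show thesis using that P A_eq by simp
qed

end

section \<open>Idempotents as power bounded matrices, and assembly of the equivalences\<close>

lemma idempotent_pow:
  fixes P :: "complex mat"
  assumes "P \<in> carrier_mat d d" "P * P = P"
  shows "P ^\<^sub>m Suc n = P"
  using assms by (induct n) auto

lemma idempotent_power_bounded:
  assumes P: "P \<in> carrier_mat d d" and PP: "P * P = P"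
  shows "power_bounded d P"
  unfolding power_bounded_def
proof (intro exI allI)
  fix n
  \<comment> \<open>The exponent 0 gives the identity, every other exponent gives
    \<open>P\<close>.\<close>
  show "op_norm d (P ^\<^sub>m n) \<le> max (op_norm d (1\<^sub>m d)) (op_norm d P)"
    using P idempotent_pow[OF P PP] by (cases n) auto
qed

lemma idempotent_gram_tendsto:
  assumes P: "P \<in> carrier_mat d d" and PP: "P * P = P"
  shows "mat_tendsto d (\<lambda>n. mat_adjoint (P ^\<^sub>m n) * P ^\<^sub>m n) (mat_adjoint P * P)"
proof -
  have Pn: "P ^\<^sub>m n \<in> carrier_mat d d" for n using P by simp
  have "(\<lambda>n. (mat_adjoint (P ^\<^sub>m n) * P ^\<^sub>m n) $$ (i, j)) \<longlonglongrightarrow> (mat_adjoint P * P) $$ (i, j)" for i j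
    \<comment> \<open>The sequence is constant from exponent 1 on, so the index is shifted past the
      identity.\<close>
    by (rule LIMSEQ_offset[where k = 1]) (simp only: Suc_eq_plus1[symmetric] idempotent_pow[OF P PP] tendsto_const)
  then show ?thesis using gram_carrier[OF P] by (subst mat_tendsto_iff_entrywise) (auto intro: gram_carrier[OF Pn])
qed

lemma psd_eigenbasis:
  assumes "psd d A"
  obtains U lam where "unitary_eigenbasis d A U lam"
proof -
  have A: "A \<in> carrier_mat d d" "mat_adjoint A = A" using assms unfolding psd_def by auto
  obtain U lam where "U \<in> carrier_mat d d" "mat_adjoint U * U = 1\<^sub>m d" "U * mat_adjoint U = 1\<^sub>m d"
    "\<And>i. i < d \<Longrightarrow> A *\<^sub>v col U i = complex_of_real (lam i) \<cdot>\<^sub>v col U i"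
    using hermitian_unitary_diagonalization[OF A] by blast
  then show thesis using that[of U lam] A by (simp add: unitary_eigenbasis_def)
qed

theorem mainTheorem10:
  fixes d :: nat
  shows "(\<forall>T \<in> carrier_mat d d. power_bounded d T \<longrightarrow>
      (mat_convergent d (\<lambda>n. mat_adjoint (T ^\<^sub>m n) * T ^\<^sub>m n) \<longleftrightarrow>
       (\<forall>l m v w. eigenvalue T l \<longrightarrow> eigenvalue T m \<longrightarrow> cmod l = 1 \<longrightarrow> cmod m = 1 \<longrightarrow>
          l \<noteq> m \<longrightarrow> v \<in> carrier_vec d \<longrightarrow> w \<in> carrier_vec d \<longrightarrow>
          T *\<^sub>v v = l \<cdot>\<^sub>v v \<longrightarrow> T *\<^sub>v w = m \<cdot>\<^sub>v w \<longrightarrow> v \<bullet>c w = 0))) \<and>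
        {A. \<exists>T \<in> carrier_mat d d. power_bounded d T \<and>
              mat_tendsto d (\<lambda>n. mat_adjoint (T ^\<^sub>m n) * T ^\<^sub>m n) A}
         = {mat_adjoint P * P | P. P \<in> carrier_mat d d \<and> P * P = P} \<and>
        {mat_adjoint P * P | P. P \<in> carrier_mat d d \<and> P * P = P}
         = {A. psd d A \<and> spectrum A \<subseteq> {0} \<union> {complex_of_real r | r. r \<ge> 1} \<and>
              kernel_dim A \<ge> mat_rank d (spectral_measure d A {complex_of_real r | r. r > 1})}"
proof (intro conjI ballI impI)
  fix T assume T: "T \<in> carrier_mat d d" and pb: "power_bounded d T"
  show "mat_convergent d (\<lambda>n. mat_adjoint (T ^\<^sub>m n) * T ^\<^sub>m n) \<longleftrightarrow>
       (\<forall>l m v w. eigenvalue T l \<longrightarrow> eigenvalue T m \<longrightarrow> cmod l = 1 \<longrightarrow> cmod m = 1 \<longrightarrow>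
          l \<noteq> m \<longrightarrow> v \<in> carrier_vec d \<longrightarrow> w \<in> carrier_vec d \<longrightarrow>
          T *\<^sub>v v = l \<cdot>\<^sub>v v \<longrightarrow> T *\<^sub>v w = m \<cdot>\<^sub>v w \<longrightarrow> v \<bullet>c w = 0)" (is "?conv \<longleftrightarrow> ?orth")
  proof
    assume ?conv
    then show ?orth unfolding mat_convergent_def using gram_limit_orthogonal[OF T] by blast
  next
    assume orth: ?orth
    obtain P where "mat_tendsto d (\<lambda>n. mat_adjoint (T ^\<^sub>m n) * T ^\<^sub>m n) (mat_adjoint P * P)"
      by (rule orbit_gram_tendsto[OF T pb]) (use orth in blast)+
    then show ?conv unfolding mat_convergent_def by blast
  qed
next
  show "{A. \<exists>T \<in> carrier_mat d d. power_bounded d T \<and>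
              mat_tendsto d (\<lambda>n. mat_adjoint (T ^\<^sub>m n) * T ^\<^sub>m n) A}
         = {mat_adjoint P * P | P. P \<in> carrier_mat d d \<and> P * P = P}" (is "?L = ?G")
  proof (intro equalityI subsetI)
    fix A assume "A \<in> ?L"
    then obtain T where T: "T \<in> carrier_mat d d" and pb: "power_bounded d T"
      and lim: "mat_tendsto d (\<lambda>n. mat_adjoint (T ^\<^sub>m n) * T ^\<^sub>m n) A" by auto
    obtain P where P: "P \<in> carrier_mat d d" "P * P = P"
      and lim': "mat_tendsto d (\<lambda>n. mat_adjoint (T ^\<^sub>m n) * T ^\<^sub>m n) (mat_adjoint P * P)"
      \<comment> \<open>The existence of the limit \<open>A\<close> supplies the orthogonality
        hypothesis; uniqueness of limits then identifies \<open>A\<close> with the Gram matrix of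
        \<open>P\<close>.\<close>
      by (rule orbit_gram_tendsto[OF T pb]) (use gram_limit_orthogonal[OF T lim] in blast)+
    have "A = mat_adjoint P * P"
      by (rule mat_tendsto_unique[OF _ lim lim']) (use T in \<open>auto intro!: gram_carrier\<close>)
    then show "A \<in> ?G" using P by blast
  next
    fix A assume "A \<in> ?G"
    then obtain P where "P \<in> carrier_mat d d" "P * P = P" "A = mat_adjoint P * P" by blast
    then show "A \<in> ?L" using idempotent_power_bounded idempotent_gram_tendsto by blast
  qed
next
  show "{mat_adjoint P * P | P. P \<in> carrier_mat d d \<and> P * P = P}
         = {A. psd d A \<and> spectrum A \<subseteq> {0} \<union> {complex_of_real r | r. r \<ge> 1} \<and>
              kernel_dim A \<ge> mat_rank d (spectral_measure d A {complex_of_real r | r. r > 1})}"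
    (is "?G = ?S")
  proof (intro equalityI subsetI)
    fix A assume "A \<in> ?G"
    then obtain P where P: "P \<in> carrier_mat d d" "P * P = P" and AP: "A = mat_adjoint P * P" by blast
    have psd: "psd d A" unfolding AP by (rule gram_psd[OF P(1)])
    then obtain U lam where eb: "unitary_eigenbasis d A U lam" by (rule psd_eigenbasis)
    show "A \<in> ?S"
      using psd idempotent_gram_spectrum[OF P] idempotent_gram_kernel_dim[OF eb P AP]
      unfolding mem_Collect_eq mat_rank_spectral_measure_gt_1[OF eb] AP[symmetric]
      by blast
  next
    fix A assume "A \<in> ?S"
    then have psd: "psd d A" and spec: "spectrum A \<subseteq> {0} \<union> {complex_of_real r | r. r \<ge> 1}"
      and dim: "kernel_dim A \<ge> mat_rank d (spectral_measure d A {complex_of_real r | r. r > 1})" by auto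
    obtain U lam where eb: "unitary_eigenbasis d A U lam" using psd by (rule psd_eigenbasis)
    have "lam i = 0 \<or> lam i \<ge> 1" if "i < d" for i
    proof -
      \<comment> \<open>Each \<open>lam i\<close> is attained by a column of the eigenbasis, so the
        spectral condition restricts every diagonal value.\<close>
      have "complex_of_real (lam i) \<in> spectrum A"
        using eigenvector_col_U[OF eb that] unfolding spectrum_def eigenvalue_def by blast
      then show ?thesis using spec by auto
    qed
    then obtain P where "P \<in> carrier_mat d d" "P * P = P" "A = mat_adjoint P * P"
      using gram_of_idempotent[OF eb] dim
      unfolding mat_rank_spectral_measure_gt_1[OF eb] kernel_dim_eq[OF eb]
      by blast
    then show "A \<in> ?G" by blast
  qed
qed

end
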